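(* Let $f(\mathbf z,\bar{\mathbf z})$ be a strongly non-degenerate mixed polynomial in $n$ complex variables which is locally tame along its vanishing coordinate subspaces, and let $V=f^{-1}(0)$. Consider the canonical stratification of $\mathbb C^n$ $$\mathcal S_{can}=\{V\cap\mathbb C^{*I},\ \mathbb C^{*I}\setminus (V\cap\mathbb C^I)\mid I\in\mathcal I_{nv}(f)\}\cup\{\mathbb C^{*I}\mid I\in\mathcal I_v(f)\}.$$ Then $f$ satisfies Thom's $a_f$-condition with respect to $\mathcal S_{can}$ (locally at the origin).
   Context: A mixed polynomial is a finite sum $f(\mathbf z,\bar{\mathbf z})=\sum_{\nu,\mu}c_{\nu\mu}\mathbf z^\nu\bar{\mathbf z}^\mu$ with $\mathbf z\in\mathbb C^n$, $\nu,\mu\in\mathbb Z_{\ge0}^n$, viewed as a real analytic map $f:\mathbb C^n=\mathbb R^{2n}\to\mathbb C=\mathbb R^2$. A critical point of such a map is a point where the real differential has rank $<2$. $B_r$ is the ball of radius $r$ centered at the origin. $a_f$-condition: $f$ satisfies Thom's $a_f$-condition with respect to a stratification $\mathcal S$ of $\mathbb C^n$ for which $V$ is a union of strata (locally at $\mathbf 0$) if there are $r>0$ and $0<\delta\ll r$ such that $V_\eta=f^{-1}(\eta)$ is smooth (contains no critical point of $f$) in $B_r$ for $0<|\eta|\le\delta$, and for any sequence $\mathbf z^{(\nu)}$ in $B_r$ with $f(\mathbf z^{(\nu)})\ne0$ converging to a point $\mathbf w\ne\mathbf 0$ with $\mathbf w\in M$, $M\subset V$ a stratum of $\mathcal S$,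 such that the tangent spaces $T_{\mathbf z^{(\nu)}}f^{-1}(f(\mathbf z^{(\nu)}))$ converge to some $\tau$ in the Grassmannian of real $(2n-2)$-planes, one has $T_{\mathbf w}M\subset\tau$. For $I\subset\{1,\dots,n\}$: $\mathbb C^I=\{\mathbf z: z_j=0\ \forall j\notin I\}$, $\mathbb C^{*I}=\{\mathbf z\in\mathbb C^I: z_j\ne0\ \forall j\in I\}$, $\mathbb C^{*n}=(\mathbb C\setminus\{0\})^n$, $f^I=f|_{\mathbb C^I}$, $I^c$ is the complement. $\mathcal I_{nv}(f)=\{I: f^I\not\equiv0\}$ and $\mathcal I_v(f)=\{I: f^I\equiv0\}$. For nonempty $I\in\mathcal I_v(f)$, $\mathbb C^I$ is called a vanishing coordinate subspace. Newton boundary: $\Gamma_+(f)$ is the convex hull of $\bigcup_{c_{\nu\mu}\ne0}(\nu+\mu+\mathbb R_{\ge0}^n)$, and $\Gamma(f)$ is the union of its compact faces. For a non-negative weight vector $P={}^t(p_1,\dots,p_n)$ let $d(P)$ be the minimum of $\xi\mapsto\sum p_i\xi_i$ on $\Gamma_+(f)$, $\Delta(P)$ the face where it is attained, and $I(P)=\{i: p_i=0\}$. A non-compact face $\Xi$ of $\Gamma_+(f)$ is essential if there is a non-negative weight $P$ with $\Delta(P)=\Xi$, $f^{I(P)}\equiv0$, and $\nu+\mathbb R_{\ge0}E_i\subset\Xi$ for all $i\in I(P)$, $\nu\in\Xi$ ($E_i$ the $i$-th unit vector). $I(P)$ depends only on $\Xi$ and is denoted $I(\Xi)$. $\Gamma_{nc}(f)$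 is $\Gamma(f)$ together with all essential non-compact faces. For a face $\Delta$, $f_\Delta=\sum_{\nu+\mu\in\Delta}c_{\nu\mu}\mathbf z^\nu\bar{\mathbf z}^\mu$. $f$ is strongly non-degenerate if (i) for every compact face $\Delta\subset\Gamma_{nc}(f)$, $f_\Delta:\mathbb C^{*n}\to\mathbb C$ has no critical point, and (ii) for every non-compact face $\Delta\in\Gamma_{nc}(f)$, $f_{\Delta_0}:\mathbb C^{*n}\to\mathbb C$ has no critical point, where $\Delta_0=\Delta\cap\Gamma(f)$. Local tameness: for an essential non-compact face $\Delta$ put $\rho_\Delta(\mathbf z)=\sum_{j\in I(\Delta)}|z_j|^2$ and $V_\Delta^*=f_\Delta^{-1}(0)\cap\mathbb C^{*n}$. $f_\Delta$ is locally tame if there is $r_\Delta>0$ such that for any fixed nonzero values $z_j\ (j\in I(\Delta))$ with $\rho_\Delta(\mathbf z)\le r_\Delta^2$, $f_\Delta$, as a mixed polynomial function of the remaining variables $\{z_k: k\notin I(\Delta)\}$, has no critical points in $\mathbb C^{*I(\Delta)^c}$; moreover $r_\Delta$ is chosen (possible, after shrinking, because $f$ is a polynomial) so that $\rho_\Delta|_{V_\Delta^*}$ has no critical value in $(0,r_\Delta^2]$. $f$ is locally tame on $\mathbb C^I$ if every $f_\Delta$ with $\Delta$ essential non-compact and $I(\Delta)=I$ is locally tame; $f$ is locally tame along vanishing coordinate subspaces if this holds for every nonempty $I\in\mathcal I_v(f)$. *)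

theory Defs
  imports "HOL-Analysis.Analysis" "HOL-Library.Poly_Mapping"
begin

section \<open>Mixed polynomials\<close>

text \<open>The key \<open>(\<nu>, \<mu>)\<close> stands for the monomial with exponents \<open>\<nu>\<close> in the variables and
  \<open>\<mu>\<close> in their complex conjugates; the number of variables is the cardinality of \<open>'n\<close>.\<close>

type_synonym 'n mixed_poly = "(('n \<Rightarrow> nat) \<times> ('n \<Rightarrow> nat)) \<Rightarrow>\<^sub>0 complex"

definition mixed_monom :: "('n::finite \<Rightarrow> nat) \<times> ('n \<Rightarrow> nat) \<Rightarrow> complex ^ 'n \<Rightarrow> complex" where
  "mixed_monom m z = (\<Prod>i\<in>UNIV. (z $ i) ^ fst m i * cnj (z $ i) ^ snd m i)"

definition mixed_eval :: "'n::finite mixed_poly \<Rightarrow> complex ^ 'n \<Rightarrow> complex" where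
  "mixed_eval f z = (\<Sum>m\<in>Poly_Mapping.keys f. Poly_Mapping.lookup f m * mixed_monom m z)"

definition total_exponent :: "('n::finite \<Rightarrow> nat) \<times> ('n \<Rightarrow> nat) \<Rightarrow> real ^ 'n" where
  "total_exponent m = (\<chi> i. real (fst m i + snd m i))"

text \<open>The sum of the terms of \<open>f\<close> whose exponent lies in \<open>\<Delta>\<close>, that is \<open>f\<^sub>\<Delta>\<close>.\<close>

definition face_fun :: "'n::finite mixed_poly \<Rightarrow> (real ^ 'n) set \<Rightarrow> complex ^ 'n \<Rightarrow> complex" where
  "face_fun f \<Delta> z =
     (\<Sum>m\<in>{m \<in> Poly_Mapping.keys f. total_exponent m \<in> \<Delta>}. Poly_Mapping.lookup f m * mixed_monom m z)"


section \<open>Critical points and tangent spaces\<close>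

text \<open>The differential is real: \<open>complex ^ 'n\<close> and \<open>complex\<close> are real vector spaces here,
  and \<open>dim\<close> is the real dimension.\<close>

definition critical_point :: "(complex ^ 'n::finite \<Rightarrow> complex) \<Rightarrow> complex ^ 'n \<Rightarrow> bool" where
  "critical_point f z \<longleftrightarrow> dim (range (frechet_derivative f (at z))) < 2"

text \<open>Velocity vectors at \<open>w\<close> of curves in \<open>M\<close>.  At a point where \<open>M\<close> is a submanifold this is
  the usual tangent space.\<close>

definition tangent_space :: "'a::real_normed_vector set \<Rightarrow> 'a \<Rightarrow> 'a set" where
  "tangent_space M w =
     {v. \<exists>\<gamma> :: real \<Rightarrow> 'a. \<gamma> 0 = w \<and> (\<forall>\<^sub>F t in nhds 0. \<gamma> t \<in> M) \<and>
           (\<gamma> has_vector_derivative v) (at 0)}"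

text \<open>\<open>y\<close> is a critical value of the restriction of the real function \<open>g\<close> to \<open>M\<close>.\<close>

definition critical_value_on :: "'a::real_normed_vector set \<Rightarrow> ('a \<Rightarrow> real) \<Rightarrow> real \<Rightarrow> bool" where
  "critical_value_on M g y \<longleftrightarrow>
     (\<exists>z\<in>M. g z = y \<and> (\<forall>v\<in>tangent_space M z. frechet_derivative g (at z) v = 0))"

text \<open>Convergence in the Grassmannian of \<open>d\<close>-planes, whose topology is that of the associated
  orthogonal projections; for a subspace \<open>W\<close> the orthogonal projection is \<open>closest_point W\<close>.\<close>

definition grassmannian_tendsto ::
    "nat \<Rightarrow> (nat \<Rightarrow> 'a::euclidean_space set) \<Rightarrow> 'a set \<Rightarrow> bool" where
  "grassmannian_tendsto d W \<tau> \<longleftrightarrow>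
     (\<forall>\<^sub>F k in sequentially. subspace (W k) \<and> dim (W k) = d) \<and>
     subspace \<tau> \<and> dim \<tau> = d \<and>
     (\<forall>x. (\<lambda>k. closest_point (W k) x) \<longlonglongrightarrow> closest_point \<tau> x)"


section \<open>Stratifications and Thom's condition\<close>

text \<open>\<open>C\<^sup>\<infinity>\<close> on an open set: all iterated directional derivatives exist and are differentiable.\<close>

coinductive smooth_on ::
    "'a::real_normed_vector set \<Rightarrow> ('a \<Rightarrow> 'b::real_normed_vector) \<Rightarrow> bool" for U where
  "\<lbrakk>\<forall>x\<in>U. f differentiable (at x);
    \<forall>v. smooth_on U (\<lambda>x. frechet_derivative f (at x) v)\<rbrakk> \<Longrightarrow> smooth_on U f"

text \<open>Near \<open>w\<close>, \<open>M\<close> is the zero set of a smooth submersion onto a vector space \<open>W\<close>.  There is no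
  loss in realising \<open>W\<close> inside the ambient space, since the codimension is at most its dimension.\<close>

definition smooth_submanifold_at :: "'a::euclidean_space set \<Rightarrow> 'a \<Rightarrow> bool" where
  "smooth_submanifold_at M w \<longleftrightarrow>
     (\<exists>U (g :: 'a \<Rightarrow> 'a) W. open U \<and> w \<in> U \<and> smooth_on U g \<and> subspace W \<and> g ` U \<subseteq> W \<and>
        range (frechet_derivative g (at w)) = W \<and> M \<inter> U = {x \<in> U. g x = 0})"

text \<open>Some strata may be empty, so \<open>partition_on\<close> is not used.\<close>

definition stratification_at_origin :: "'a::euclidean_space set set \<Rightarrow> bool" where
  "stratification_at_origin S \<longleftrightarrow>
     \<Union>S = UNIV \<and> pairwise disjnt S \<and>
     (\<exists>r>0. finite {M \<in> S. M \<inter> cball 0 r \<noteq> {}} \<and>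
            (\<forall>M\<in>S. \<forall>w \<in> M \<inter> cball 0 r. smooth_submanifold_at M w))"

definition thom_af_condition ::
    "(complex ^ 'n::finite \<Rightarrow> complex) \<Rightarrow> (complex ^ 'n) set set \<Rightarrow> bool" where
  "thom_af_condition f S \<longleftrightarrow>
     stratification_at_origin S \<and>
     (\<exists>r>0. f -` {0} \<inter> cball 0 r = \<Union>{M \<in> S. M \<subseteq> f -` {0}} \<inter> cball 0 r) \<and>
     (\<exists>r>0. \<exists>\<delta>>0. \<delta> < r \<and>
        (\<forall>\<eta>. 0 < norm \<eta> \<and> norm \<eta> \<le> \<delta> \<longrightarrow>
           (\<forall>z \<in> f -` {\<eta>} \<inter> cball 0 r. \<not> critical_point f z)) \<and>
        (\<forall>(z :: nat \<Rightarrow> complex ^ 'n) w M \<tau>.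
           (\<forall>k. z k \<in> cball 0 r \<and> f (z k) \<noteq> 0) \<and> z \<longlonglongrightarrow> w \<and> w \<noteq> 0 \<and>
           M \<in> S \<and> M \<subseteq> f -` {0} \<and> w \<in> M \<and>
           grassmannian_tendsto (2 * CARD('n) - 2)
             (\<lambda>k. tangent_space (f -` {f (z k)}) (z k)) \<tau> \<longrightarrow>
           tangent_space M w \<subseteq> \<tau>))"


section \<open>Coordinate subspaces and the canonical stratification\<close>

definition coord_subspace :: "'n::finite set \<Rightarrow> (complex ^ 'n) set" where
  "coord_subspace I = {z. \<forall>j. j \<notin> I \<longrightarrow> z $ j = 0}"

definition coord_torus :: "'n::finite set \<Rightarrow> (complex ^ 'n) set" where
  "coord_torus I = {z \<in> coord_subspace I. \<forall>j\<in>I. z $ j \<noteq> 0}"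

definition vanishing_sets :: "'n::finite mixed_poly \<Rightarrow> 'n set set" where
  "vanishing_sets f = {I. \<forall>z\<in>coord_subspace I. mixed_eval f z = 0}"

definition nonvanishing_sets :: "'n::finite mixed_poly \<Rightarrow> 'n set set" where
  "nonvanishing_sets f = {I. \<exists>z\<in>coord_subspace I. mixed_eval f z \<noteq> 0}"

definition canonical_stratification :: "'n::finite mixed_poly \<Rightarrow> (complex ^ 'n) set set" where
  "canonical_stratification f =
     (let V = mixed_eval f -` {0} in
        (\<Union>I\<in>nonvanishing_sets f.
           {V \<inter> coord_torus I, coord_torus I - (V \<inter> coord_subspace I)}) \<union>
        {coord_torus I |I. I \<in> vanishing_sets f})"


section \<open>Newton boundary\<close>

definition newton_polyhedron :: "'n::finite mixed_poly \<Rightarrow> (real ^ 'n) set" where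
  "newton_polyhedron f =
     convex hull (\<Union>m\<in>Poly_Mapping.keys f. {total_exponent m + \<xi> |\<xi>. \<forall>i. 0 \<le> \<xi> $ i})"

text \<open>The library's \<open>face_of\<close> admits the empty set as a face, which is excluded here.\<close>

definition compact_face :: "'n::finite mixed_poly \<Rightarrow> (real ^ 'n) set \<Rightarrow> bool" where
  "compact_face f \<Delta> \<longleftrightarrow> \<Delta> face_of newton_polyhedron f \<and> \<Delta> \<noteq> {} \<and> compact \<Delta>"

definition newton_boundary :: "'n::finite mixed_poly \<Rightarrow> (real ^ 'n) set" where
  "newton_boundary f = \<Union>{\<Delta>. compact_face f \<Delta>}"

definition weight_face :: "'n::finite mixed_poly \<Rightarrow> real ^ 'n \<Rightarrow> (real ^ 'n) set" where
  "weight_face f P =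
     {\<xi> \<in> newton_polyhedron f. \<forall>\<xi>' \<in> newton_polyhedron f. P \<bullet> \<xi> \<le> P \<bullet> \<xi>'}"

definition weight_zeros :: "real ^ 'n::finite \<Rightarrow> 'n set" where
  "weight_zeros P = {i. P $ i = 0}"

text \<open>\<open>\<Xi>\<close> is an essential non-compact face with \<open>I(\<Xi>) = I\<close>.  The set \<open>I\<close> is determined by \<open>\<Xi>\<close>:
  it consists of the \<open>i\<close> with \<open>\<Xi> + \<real>\<^sub>\<ge>\<^sub>0 E\<^sub>i \<subseteq> \<Xi>\<close>.\<close>

definition essential_face_on ::
    "'n::finite mixed_poly \<Rightarrow> 'n set \<Rightarrow> (real ^ 'n) set \<Rightarrow> bool" where
  "essential_face_on f I \<Xi> \<longleftrightarrow>
     \<not> compact \<Xi> \<and>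
     (\<exists>P. (\<forall>i. 0 \<le> P $ i) \<and> weight_face f P = \<Xi> \<and> weight_zeros P = I \<and>
          I \<in> vanishing_sets f \<and>
          (\<forall>i\<in>I. \<forall>\<xi>\<in>\<Xi>. \<forall>t\<ge>0. \<xi> + t *\<^sub>R axis i 1 \<in> \<Xi>))"

definition essential_face :: "'n::finite mixed_poly \<Rightarrow> (real ^ 'n) set \<Rightarrow> bool" where
  "essential_face f \<Xi> \<longleftrightarrow> (\<exists>I. essential_face_on f I \<Xi>)"

definition newton_boundary_nc :: "'n::finite mixed_poly \<Rightarrow> (real ^ 'n) set" where
  "newton_boundary_nc f = newton_boundary f \<union> \<Union>{\<Xi>. essential_face f \<Xi>}"

definition strongly_nondegenerate :: "'n::finite mixed_poly \<Rightarrow> bool" where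
  "strongly_nondegenerate f \<longleftrightarrow>
     (\<forall>\<Delta>. compact_face f \<Delta> \<and> \<Delta> \<subseteq> newton_boundary_nc f \<longrightarrow>
        (\<forall>z\<in>coord_torus UNIV. \<not> critical_point (face_fun f \<Delta>) z)) \<and>
     (\<forall>\<Delta>. essential_face f \<Delta> \<longrightarrow>
        (\<forall>z\<in>coord_torus UNIV. \<not> critical_point (face_fun f (\<Delta> \<inter> newton_boundary f)) z))"


section \<open>Local tameness\<close>

definition partial_norm_sq :: "'n::finite set \<Rightarrow> complex ^ 'n \<Rightarrow> real" where
  "partial_norm_sq I z = (\<Sum>j\<in>I. (cmod (z $ j))\<^sup>2)"

definition merge_coords :: "'n::finite set \<Rightarrow> complex ^ 'n \<Rightarrow> complex ^ 'n \<Rightarrow> complex ^ 'n" where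
  "merge_coords I a w = (\<chi> j. if j \<in> I then a $ j else w $ j)"

text \<open>The function \<open>f\<^sub>\<Delta>\<close> of the variables outside \<open>I\<close>, the others being fixed to those of \<open>a\<close>, is
  regarded as a function on the whole space that is constant in the coordinates in \<open>I\<close>; this does
  not affect the rank of its differential.\<close>

definition locally_tame_face ::
    "'n::finite mixed_poly \<Rightarrow> 'n set \<Rightarrow> (real ^ 'n) set \<Rightarrow> bool" where
  "locally_tame_face f I \<Delta> \<longleftrightarrow>
     (\<exists>r>0.
        (\<forall>a. (\<forall>j\<in>I. a $ j \<noteq> 0) \<and> partial_norm_sq I a \<le> r\<^sup>2 \<longrightarrow>
           (\<forall>w\<in>coord_torus (- I). \<not> critical_point (\<lambda>w. face_fun f \<Delta> (merge_coords I a w)) w)) \<and>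
        (\<forall>y\<in>{0<..r\<^sup>2}.
           \<not> critical_value_on (face_fun f \<Delta> -` {0} \<inter> coord_torus UNIV) (partial_norm_sq I) y))"

definition locally_tame_on :: "'n::finite mixed_poly \<Rightarrow> 'n set \<Rightarrow> bool" where
  "locally_tame_on f I \<longleftrightarrow> (\<forall>\<Delta>. essential_face_on f I \<Delta> \<longrightarrow> locally_tame_face f I \<Delta>)"

definition locally_tame_along_vanishing :: "'n::finite mixed_poly \<Rightarrow> bool" where
  "locally_tame_along_vanishing f \<longleftrightarrow>
     (\<forall>I\<in>vanishing_sets f. I \<noteq> {} \<longrightarrow> locally_tame_on f I)"

end

theory Submission
  imports Defs
begin

text \<open>Thom's condition is a statement about the differential of \<open>f\<close> along sequences, and every
  convergent sequence \<open>z\<^sub>k \<longlonglongrightarrow> w\<close> outside the zero set is governed by a single weight, up to passing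
  to a subsequence: there are a weight \<open>P\<close> that vanishes exactly on the coordinates in which
  \<open>w\<close> is nonzero, scales \<open>c\<^sub>k > 0\<close>, and a point \<open>a\<close> of the torus that agrees with \<open>w\<close> on
  those coordinates, such that for every monomial \<open>m\<close> of \<open>f\<close> the quotient \<open>m(z\<^sub>k) / c\<^sub>k\<close> tends to
  \<open>m(a)\<close> if the exponent of \<open>m\<close> lies in the face \<open>\<Delta>(P)\<close>, and to \<open>0\<close> otherwise
  (\<open>toric_asymptotics\<close>, \<open>monomial_asymptotics\<close>).  This is linear algebra with the logarithms of
  the absolute values of the coordinates, and it replaces the curve selection lemma.  In a direction
  \<open>z * u\<close>, with the componentwise product, differentiation multiplies a monomial by a number
  independent of \<open>z\<close>.  Hence the differentials of \<open>f\<close> at \<open>z\<^sub>k\<close> in the directions \<open>z\<^sub>k * u\<close>,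
  divided by \<open>c\<^sub>k\<close>, tend to the differential of \<open>f\<^sub>\<Delta>\<close> at \<open>a\<close> in the direction \<open>a * u\<close>
  (\<open>frechet_derivative_asymptotics\<close>).

  For \<open>w = 0\<close> the weight is positive, \<open>\<Delta>(P)\<close> is compact, and \<open>f\<^sub>\<Delta>\<close> has no critical point in
  the torus.  Therefore, on some ball around the origin, \<open>f\<^sup>I\<close> has no critical point with all
  coordinates in \<open>I\<close> nonzero, whenever \<open>f\<^sup>I\<close> does not vanish identically
  (\<open>torus_submersive_near_origin\<close>).  This makes the strata smooth and the fibres over nonzero values
  free of critical points.  It also gives Thom's condition at the points \<open>w\<close> of the zero set that
  lie in such a coordinate torus, since there the kernels of the differentials converge to the kernel
  at \<open>w\<close>.

  Now let \<open>w \<noteq> 0\<close> have nonzero coordinates exactly in \<open>I\<close>, where \<open>f\<^sup>I = 0\<close>.  Then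
  \<open>\<Delta>(P)\<close> is an essential face, and tameness makes \<open>f\<^sub>\<Delta>\<close> submersive at \<open>a\<close> in the variables
  outside \<open>I\<close>.  The derivative of \<open>f\<close> at \<open>z\<^sub>k\<close> along a vector \<open>v \<in> \<complex>\<^sup>I\<close> is of order at
  most \<open>c\<^sub>k\<close>, so it is cancelled by a vector \<open>z\<^sub>k * u\<close> with \<open>u\<close> bounded and supported outside
  \<open>I\<close>, where the coordinates of \<open>z\<^sub>k\<close> tend to \<open>0\<close>.  So \<open>v\<close> is a limit of vectors tangent
  to the fibres (\<open>tangent_limit_at_vanishing_point\<close>).\<close>

section \<open>Polynomial maps of real vector spaces\<close>

text \<open>This closure property is what allows the coinduction that proves polynomial maps smooth, and it
  gives the continuity in \<open>z\<close> of the differential of \<open>f\<close>.\<close>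

lemma polynomial_function_frechet_derivative:
  fixes f :: "'a::real_normed_vector \<Rightarrow> 'b::euclidean_space"
  assumes "polynomial_function f"
  shows "polynomial_function (\<lambda>x. frechet_derivative f (at x) v)"
proof -
  have real: "(\<lambda>x. p x) differentiable (at x)
      \<and> real_polynomial_function (\<lambda>x. frechet_derivative p (at x) v)"
    if "real_polynomial_function p" for p :: "'a \<Rightarrow> real" and x
    using that
  proof (induction arbitrary: x rule: real_polynomial_function.induct)
    case (linear p)
    have "frechet_derivative p (at x) = p" for x
      by (rule frechet_derivative_at[OF bounded_linear_imp_has_derivative[OF linear], symmetric])
    then show ?case
      using bounded_linear_imp_differentiable[OF linear]
      by (simp add: real_polynomial_function.intros(2))
  next
    case (const c)
    then show ?case by (simp add: real_polynomial_function.intros(2))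
  next
    case (add p q)
    have "((\<lambda>x. p x + q x) has_derivative
        (\<lambda>h. frechet_derivative p (at x) h + frechet_derivative q (at x) h)) (at x)" for x
      using add.IH frechet_derivative_works by (blast intro: has_derivative_add)
    then have "frechet_derivative (\<lambda>x. p x + q x) (at x)
        = (\<lambda>h. frechet_derivative p (at x) h + frechet_derivative q (at x) h)" for x
      by (rule frechet_derivative_at[symmetric])
    with add show ?case by (auto intro!: differentiable_add)
  next
    case (mult p q)
    have "((\<lambda>x. p x * q x) has_derivative
        (\<lambda>h. p x * frechet_derivative q (at x) h + frechet_derivative p (at x) h * q x)) (at x)" for x
      using mult.IH frechet_derivative_works by (blast intro: has_derivative_mult)
    then have "frechet_derivative (\<lambda>x. p x * q x) (at x)
        = (\<lambda>h. p x * frechet_derivative q (at x) h + frechet_derivative p (at x) h * q x)" for x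
      by (rule frechet_derivative_at[symmetric])
    with mult show ?case
      by (auto intro!: real_polynomial_function.intros(3,4) differentiable_mult)
  qed
  have "frechet_derivative f (at x) v \<bullet> b = frechet_derivative (\<lambda>x. f x \<bullet> b) (at x) v" for x b
  proof -
    have "(f has_derivative frechet_derivative f (at x)) (at x)"
      using assms differentiable_at_polynomial_function frechet_derivative_works by blast
    then have "((\<lambda>x. f x \<bullet> b) has_derivative (\<lambda>h. frechet_derivative f (at x) h \<bullet> b)) (at x)"
      by (rule has_derivative_inner_left)
    then have "frechet_derivative (\<lambda>x. f x \<bullet> b) (at x) = (\<lambda>h. frechet_derivative f (at x) h \<bullet> b)"
      by (rule frechet_derivative_at[symmetric])
    then show ?thesis
      by simp
  qed
  then show ?thesis
    using assms real by (simp add: polynomial_function_iff_Basis_inner)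
qed

lemma smooth_on_polynomial_function:
  fixes f :: "'a::real_normed_vector \<Rightarrow> 'b::euclidean_space"
  assumes "polynomial_function f"
  shows "smooth_on U f"
  using assms
proof (coinduction arbitrary: f)
  case smooth_on
  then show ?case
    by (auto simp: differentiable_at_polynomial_function polynomial_function_frechet_derivative)
qed

text \<open>The product is \<open>Re (f x) *\<^sub>R g x + Im (f x) *\<^sub>R (\<i> * g x)\<close>, which reduces the claim to
  multiplication by real polynomials.\<close>

lemma polynomial_function_complex_mult:
  fixes f g :: "'a::real_normed_vector \<Rightarrow> complex"
  assumes "polynomial_function f" "polynomial_function g"
  shows "polynomial_function (\<lambda>x. f x * g x)"
proof -
  have "f x * g x = Re (f x) *\<^sub>R g x + Im (f x) *\<^sub>R (\<i> * g x)" for x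
    by (simp add: complex_eq_iff)
  moreover have "polynomial_function (\<lambda>x. Re (f x))" "polynomial_function (\<lambda>x. Im (f x))"
    using polynomial_function_compose[OF assms(1) polynomial_function_bounded_linear]
      bounded_linear_Re bounded_linear_Im by (fastforce simp: o_def)+
  moreover have "polynomial_function (\<lambda>x. \<i> * g x)"
    using polynomial_function_compose[OF assms(2) polynomial_function_bounded_linear[OF bounded_linear_mult_right]]
    by (simp add: o_def)
  ultimately show ?thesis
    using assms by auto
qed


section \<open>Logarithmic derivatives of mixed polynomials\<close>

text \<open>The function \<open>f\<close> and all its face functions \<open>f\<^sub>\<Delta>\<close> are sums of this form with the same
  coefficients and different sets of exponents, so that one formula for the differential serves all of
  them.\<close>

definition mixed_sum ::
    "(('n::finite \<Rightarrow> nat) \<times> ('n \<Rightarrow> nat) \<Rightarrow> complex) \<Rightarrow> (('n \<Rightarrow> nat) \<times> ('n \<Rightarrow> nat)) set \<Rightarrow> complex ^ 'n \<Rightarrow> complex" where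
  "mixed_sum c D z = (\<Sum>m\<in>D. c m * mixed_monom m z)"

definition face_keys :: "'n::finite mixed_poly \<Rightarrow> (real ^ 'n) set \<Rightarrow> (('n \<Rightarrow> nat) \<times> ('n \<Rightarrow> nat)) set" where
  "face_keys f \<Delta> = {m \<in> Poly_Mapping.keys f. total_exponent m \<in> \<Delta>}"

lemma mixed_eval_eq_mixed_sum: "mixed_eval f = mixed_sum (Poly_Mapping.lookup f) (Poly_Mapping.keys f)"
  by (simp add: fun_eq_iff mixed_eval_def mixed_sum_def)

lemma face_fun_eq_mixed_sum: "face_fun f \<Delta> = mixed_sum (Poly_Mapping.lookup f) (face_keys f \<Delta>)"
  by (simp add: fun_eq_iff face_fun_def mixed_sum_def face_keys_def)

lemma polynomial_function_mixed_monom: "polynomial_function (mixed_monom m)"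
proof -
  have power: "polynomial_function (\<lambda>x. g x ^ k)" if "polynomial_function g"
    for g :: "complex ^ 'a \<Rightarrow> complex" and k
    by (induction k) (auto intro: polynomial_function_complex_mult that)
  have prod: "polynomial_function (\<lambda>x. \<Prod>i\<in>A. g i x)" if "\<And>i. polynomial_function (g i)"
    for g :: "'a \<Rightarrow> complex ^ 'a \<Rightarrow> complex" and A
    by (induction A rule: infinite_finite_induct) (auto intro: polynomial_function_complex_mult that)
  have "polynomial_function (\<lambda>z :: complex ^ 'a. z $ i)"
    and "polynomial_function (\<lambda>z :: complex ^ 'a. cnj (z $ i))" for i
    by (auto intro!: polynomial_function_bounded_linear bounded_linear_vec_nth
        bounded_linear_compose[OF bounded_linear_cnj])
  then show ?thesis
    unfolding mixed_monom_def by (intro prod polynomial_function_complex_mult power)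
qed

lemma polynomial_function_mixed_sum: "polynomial_function (mixed_sum c D)"
proof (cases "finite D")
  case True
  then show ?thesis
    unfolding mixed_sum_def
    by (intro polynomial_function_sum polynomial_function_complex_mult polynomial_function_mixed_monom) auto
qed (simp add: mixed_sum_def[abs_def])

text \<open>The derivative of the logarithm of the monomial \<open>m\<close> with respect to the logarithms of the
  coordinates, in direction \<open>u\<close>.\<close>

definition log_weight :: "('n::finite \<Rightarrow> nat) \<times> ('n \<Rightarrow> nat) \<Rightarrow> complex ^ 'n \<Rightarrow> complex" where
  "log_weight m u = (\<Sum>i\<in>UNIV. of_nat (fst m i) * u $ i + of_nat (snd m i) * cnj (u $ i))"

text \<open>In a direction \<open>z * u\<close> (componentwise product) the factor \<open>z\<^sub>i\<close> lost by differentiating a power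
  of \<open>z\<^sub>i\<close> is restored by the direction.  No coordinate has to be nonzero for this, which allows all
  coordinate subspaces to be treated together.\<close>

lemma frechet_derivative_mixed_monom:
  "frechet_derivative (mixed_monom m) (at z) (z * u) = mixed_monom m z * log_weight m u"
proof -
  define g where "g i z = (z $ i) ^ fst m i * cnj (z $ i) ^ snd m i" for i and z :: "complex ^ 'a"
  define g' where "g' i h = (z $ i) ^ fst m i * (of_nat (snd m i) * cnj (h $ i) * cnj (z $ i) ^ (snd m i - 1))
      + of_nat (fst m i) * h $ i * (z $ i) ^ (fst m i - 1) * cnj (z $ i) ^ snd m i"
    for i and h :: "complex ^ 'a"
  have coord: "((\<lambda>z. z $ i) has_derivative (\<lambda>h. h $ i)) (at z)" for i
    by (rule bounded_linear_imp_has_derivative[OF bounded_linear_vec_nth])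
  have cnj_coord: "((\<lambda>z. cnj (z $ i)) has_derivative (\<lambda>h. cnj (h $ i))) (at z)" for i
    by (rule has_derivative_cnj[OF coord])
  have "(g i has_derivative g' i) (at z)" for i
    unfolding g_def g'_def
    by (rule has_derivative_eq_rhs, rule has_derivative_mult
      [OF has_derivative_power[OF coord] has_derivative_power[OF cnj_coord]]) (auto simp: fun_eq_iff)
  then have "((\<lambda>z. \<Prod>i\<in>UNIV. g i z) has_derivative
      (\<lambda>h. \<Sum>i\<in>UNIV. g' i h * (\<Prod>j\<in>UNIV - {i}. g j z))) (at z)"
    by (intro has_derivative_prod) auto
  then have "frechet_derivative (mixed_monom m) (at z) (z * u)
      = (\<Sum>i\<in>UNIV. g' i (z * u) * (\<Prod>j\<in>UNIV - {i}. g j z))"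
    by (simp add: frechet_derivative_at[symmetric] g_def mixed_monom_def[abs_def])
  also have "\<dots> = (\<Sum>i\<in>UNIV. (of_nat (fst m i) * u $ i + of_nat (snd m i) * cnj (u $ i))
      * (g i z * (\<Prod>j\<in>UNIV - {i}. g j z)))"
  proof (rule sum.cong[OF refl])
    fix i
    have "of_nat k * (x * c) * x ^ (k - 1) = x ^ k * (of_nat k * c)" for k and x c :: complex
      by (cases k) auto
    then have "g' i (z * u) = (of_nat (fst m i) * u $ i + of_nat (snd m i) * cnj (u $ i)) * g i z"
      unfolding g_def g'_def
      by (simp only: vector_mult_component complex_cnj_mult) (simp only: algebra_simps)
    then show "g' i (z * u) * (\<Prod>j\<in>UNIV - {i}. g j z)
        = (of_nat (fst m i) * u $ i + of_nat (snd m i) * cnj (u $ i)) * (g i z * (\<Prod>j\<in>UNIV - {i}. g j z))"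
      by simp
  qed
  also have "\<dots> = mixed_monom m z * log_weight m u"
  proof -
    have "g i z * (\<Prod>j\<in>UNIV - {i}. g j z) = mixed_monom m z" for i
      unfolding mixed_monom_def g_def by (rule prod.remove[symmetric]) auto
    then show ?thesis
      by (simp add: log_weight_def sum_distrib_left mult.commute)
  qed
  finally show ?thesis .
qed

lemma mixed_sum_has_derivative:
  "(mixed_sum c D has_derivative frechet_derivative (mixed_sum c D) (at z)) (at z)"
  using differentiable_at_polynomial_function polynomial_function_mixed_sum frechet_derivative_works
  by blast

lemma frechet_derivative_mixed_sum:
  assumes "finite D"
  shows "frechet_derivative (mixed_sum c D) (at z) (z * u)
    = (\<Sum>m\<in>D. c m * mixed_monom m z * log_weight m u)"
proof -
  have monom: "(mixed_monom m has_derivative frechet_derivative (mixed_monom m) (at z)) (at z)" for m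
    using differentiable_at_polynomial_function polynomial_function_mixed_monom frechet_derivative_works
    by blast
  have "(mixed_sum c D has_derivative (\<lambda>h. \<Sum>m\<in>D. c m * frechet_derivative (mixed_monom m) (at z) h)) (at z)"
    unfolding mixed_sum_def[abs_def]
    by (intro has_derivative_sum has_derivative_mult_right monom)
  then have "frechet_derivative (mixed_sum c D) (at z)
      = (\<lambda>h. \<Sum>m\<in>D. c m * frechet_derivative (mixed_monom m) (at z) h)"
    by (rule frechet_derivative_at[symmetric])
  then show ?thesis
    by (simp add: frechet_derivative_mixed_monom mult.assoc)
qed

lemma not_critical_point_iff:
  assumes "f differentiable (at z)"
  shows "\<not> critical_point f z \<longleftrightarrow> range (frechet_derivative f (at z)) = UNIV"
proof -
  have "subspace (range (frechet_derivative f (at z)))"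
    using linear_frechet_derivative[OF assms] by (simp add: linear_subspace_image)
  then have "range (frechet_derivative f (at z)) = UNIV \<longleftrightarrow>
      dim (range (frechet_derivative f (at z))) = DIM(complex)"
    using dim_eq_full span_eq_iff by metis
  then show ?thesis
    unfolding critical_point_def
    using dim_subset_UNIV[of "range (frechet_derivative f (at z))"] by auto
qed


section \<open>Faces of the Newton polyhedron and weights\<close>

lemma key_exponent_in_newton_polyhedron:
  assumes "m \<in> Poly_Mapping.keys f"
  shows "total_exponent m \<in> newton_polyhedron f"
proof -
  have "total_exponent m \<in> {total_exponent m + \<xi> |\<xi>. \<forall>i. 0 \<le> \<xi> $ i}"
    by (rule CollectI, rule exI[of _ 0]) simp
  then show ?thesis
    unfolding newton_polyhedron_def using assms by (blast intro: hull_inc)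
qed

text \<open>Translated orthants share their recession cone, so the hull of their union is a polytope plus one
  orthant.  Closedness and invariance under translation along the coordinate rays follow.\<close>

lemma newton_polyhedron_eq_sum:
  "newton_polyhedron f
    = convex hull (total_exponent ` Poly_Mapping.keys f) + {\<xi>. \<forall>i. 0 \<le> \<xi> $ i}"
proof -
  have "(\<Union>m\<in>Poly_Mapping.keys f. {total_exponent m + \<xi> |\<xi>. \<forall>i. 0 \<le> \<xi> $ i})
      = total_exponent ` Poly_Mapping.keys f + {\<xi>. \<forall>i. 0 \<le> \<xi> $ i}"
    by (auto simp: set_plus_def)
  moreover have "convex {\<xi> :: real ^ 'a. \<forall>i. 0 \<le> \<xi> $ i}"
    by (auto simp: convex_def)
  ultimately show ?thesis
    by (simp add: newton_polyhedron_def convex_hull_set_plus hull_same)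
qed

lemma newton_polyhedron_nonneg:
  assumes "\<xi> \<in> newton_polyhedron f"
  shows "0 \<le> \<xi> $ i"
proof -
  have "newton_polyhedron f \<subseteq> {\<xi>. 0 \<le> \<xi> $ i}"
    unfolding newton_polyhedron_def
    by (rule hull_minimal) (auto simp: total_exponent_def convex_def)
  with assms show ?thesis by auto
qed

lemma newton_polyhedron_add_ray:
  assumes "\<xi> \<in> newton_polyhedron f" "0 \<le> t"
  shows "\<xi> + t *\<^sub>R axis i 1 \<in> newton_polyhedron f"
proof -
  obtain x y where xy: "x \<in> convex hull (total_exponent ` Poly_Mapping.keys f)" "\<forall>i. 0 \<le> y $ i" "\<xi> = x + y"
    using assms(1) unfolding newton_polyhedron_eq_sum set_plus_def by auto
  have "\<forall>j. 0 \<le> (y + t *\<^sub>R axis i 1) $ j"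
    using xy(2) assms(2) by (simp add: axis_def)
  then show ?thesis
    unfolding newton_polyhedron_eq_sum set_plus_def using xy
    by (auto intro!: bexI[OF _ xy(1)] exI[of _ "y + t *\<^sub>R axis i 1"])
qed

lemma weight_le_on_newton_polyhedron:
  assumes "\<forall>i. 0 \<le> P $ i" "\<forall>m\<in>Poly_Mapping.keys f. d \<le> P \<bullet> total_exponent m"
    and "\<xi> \<in> newton_polyhedron f"
  shows "d \<le> P \<bullet> \<xi>"
proof -
  have "d \<le> P \<bullet> (total_exponent m + \<zeta>)" if "m \<in> Poly_Mapping.keys f" "\<forall>i. 0 \<le> \<zeta> $ i" for m \<zeta>
  proof -
    have "0 \<le> P \<bullet> \<zeta>"
      using assms(1) that(2) by (simp add: inner_vec_def sum_nonneg)
    then show ?thesis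
      using assms(2) that(1) by (fastforce simp: inner_add_right)
  qed
  then have "newton_polyhedron f \<subseteq> {\<xi>. P \<bullet> \<xi> \<ge> d}"
    unfolding newton_polyhedron_def
    by (intro hull_minimal convex_halfspace_ge) auto
  with assms(3) show ?thesis by auto
qed

lemma weight_face_eq:
  assumes "\<forall>i. 0 \<le> P $ i" "m0 \<in> Poly_Mapping.keys f"
    and "\<forall>m\<in>Poly_Mapping.keys f. P \<bullet> total_exponent m0 \<le> P \<bullet> total_exponent m"
  shows "weight_face f P = newton_polyhedron f \<inter> {\<xi>. P \<bullet> \<xi> = P \<bullet> total_exponent m0}"
proof -
  have min: "P \<bullet> total_exponent m0 \<le> P \<bullet> \<xi>" if "\<xi> \<in> newton_polyhedron f" for \<xi>
    using weight_le_on_newton_polyhedron[OF assms(1,3) that] .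
  have "P \<bullet> \<xi> = P \<bullet> total_exponent m0" if "\<xi> \<in> weight_face f P" for \<xi>
    using that min key_exponent_in_newton_polyhedron[OF assms(2)]
    unfolding weight_face_def by (intro order.antisym) blast+
  then show ?thesis
    using min by (auto simp: weight_face_def)
qed

lemma face_keys_weight_face:
  assumes "\<forall>i. 0 \<le> P $ i" "m0 \<in> Poly_Mapping.keys f"
    and "\<forall>m\<in>Poly_Mapping.keys f. P \<bullet> total_exponent m0 \<le> P \<bullet> total_exponent m"
  shows "face_keys f (weight_face f P)
    = {m \<in> Poly_Mapping.keys f. P \<bullet> total_exponent m = P \<bullet> total_exponent m0}"
  using weight_face_eq[OF assms] key_exponent_in_newton_polyhedron
  by (auto simp: face_keys_def)

text \<open>A weight that is positive in every coordinate has bounded level sets on the orthant that contains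
  the Newton polyhedron.\<close>

lemma compact_face_weight_face:
  assumes "\<forall>i. 0 < P $ i" "m0 \<in> Poly_Mapping.keys f"
    and "\<forall>m\<in>Poly_Mapping.keys f. P \<bullet> total_exponent m0 \<le> P \<bullet> total_exponent m"
  shows "compact_face f (weight_face f P)"
proof -
  have P: "\<forall>i. 0 \<le> P $ i"
    using assms(1) by (auto intro: less_imp_le)
  note eq = weight_face_eq[OF P assms(2,3)]
  define d where "d = P \<bullet> total_exponent m0"
  have "convex (newton_polyhedron f)"
    by (simp add: newton_polyhedron_def convex_convex_hull)
  then have "weight_face f P face_of newton_polyhedron f"
    unfolding eq
    by (rule face_of_Int_supporting_hyperplane_ge)
      (rule weight_le_on_newton_polyhedron[OF P assms(3)])
  moreover have "total_exponent m0 \<in> weight_face f P"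
    using eq key_exponent_in_newton_polyhedron[OF assms(2)] by auto
  moreover have "closed (newton_polyhedron f)"
  proof -
    have "compact (convex hull (total_exponent ` Poly_Mapping.keys f))"
      by (simp add: finite_imp_compact_convex_hull)
    moreover have "closed {\<xi> :: real ^ 'a. \<forall>i. 0 \<le> \<xi> $ i}"
      by (intro closed_Collect_all closed_Collect_le continuous_intros)
    ultimately have "closed (\<Union>x\<in>convex hull (total_exponent ` Poly_Mapping.keys f).
        \<Union>y\<in>{\<xi>. \<forall>i. 0 \<le> \<xi> $ i}. {x + y})"
      by (rule compact_closed_sums)
    also have "(\<Union>x\<in>convex hull (total_exponent ` Poly_Mapping.keys f).
        \<Union>y\<in>{\<xi>. \<forall>i. 0 \<le> \<xi> $ i}. {x + y}) = newton_polyhedron f"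
      unfolding newton_polyhedron_eq_sum by (auto simp: set_plus_def)
    finally show ?thesis .
  qed
  then have "closed (weight_face f P)"
    unfolding eq by (intro closed_Int closed_hyperplane)
  moreover have "weight_face f P \<subseteq> cbox 0 (\<chi> i. d / P $ i)"
  proof
    fix \<xi> assume \<xi>: "\<xi> \<in> weight_face f P"
    have nonneg: "0 \<le> \<xi> $ i" for i
      using \<xi> eq newton_polyhedron_nonneg by blast
    have "P $ i * \<xi> $ i \<le> d" for i
    proof -
      have "P $ i * \<xi> $ i \<le> (\<Sum>j\<in>UNIV. P $ j * \<xi> $ j)"
        by (rule member_le_sum) (use P nonneg in auto)
      also have "\<dots> = d"
        using \<xi> eq by (simp add: d_def inner_vec_def)
      finally show ?thesis .
    qed
    then show "\<xi> \<in> cbox 0 (\<chi> i. d / P $ i)"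
      using nonneg assms(1) by (simp add: mem_box_cart pos_le_divide_eq mult.commute)
  qed
  then have "bounded (weight_face f P)"
    using bounded_subset bounded_cbox by blast
  ultimately show ?thesis
    unfolding compact_face_def by (auto simp: compact_eq_bounded_closed)
qed

lemma essential_face_on_weight_face:
  assumes P: "\<forall>i. 0 \<le> P $ i" and m0: "m0 \<in> Poly_Mapping.keys f"
    and min: "\<forall>m\<in>Poly_Mapping.keys f. P \<bullet> total_exponent m0 \<le> P \<bullet> total_exponent m"
    and I: "weight_zeros P \<in> vanishing_sets f" "weight_zeros P \<noteq> {}"
  shows "essential_face_on f (weight_zeros P) (weight_face f P)"
proof -
  note eq = weight_face_eq[OF P m0 min]
  have ray: "\<xi> + t *\<^sub>R axis i 1 \<in> weight_face f P"
    if "i \<in> weight_zeros P" "\<xi> \<in> weight_face f P" "0 \<le> t" for i \<xi> t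
    using that newton_polyhedron_add_ray[of \<xi> f t i]
    by (simp add: eq weight_zeros_def inner_add_right inner_axis)
  have "\<not> compact (weight_face f P)"
  proof
    assume "compact (weight_face f P)"
    then obtain B where B: "norm \<xi> \<le> B" if "\<xi> \<in> weight_face f P" for \<xi>
      using compact_imp_bounded bounded_iff by metis
    obtain i where i: "i \<in> weight_zeros P"
      using I by blast
    define t where "t = B + 1"
    have m0_face: "total_exponent m0 \<in> weight_face f P"
      using eq key_exponent_in_newton_polyhedron[OF m0] by auto
    have "0 \<le> B"
      using B[OF m0_face] norm_ge_zero order_trans by blast
    then have t: "norm (total_exponent m0 + t *\<^sub>R axis i 1) \<le> B"
      using B ray[OF i m0_face] by (simp add: t_def)
    have "t \<le> (total_exponent m0 + t *\<^sub>R axis i 1) $ i"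
      by (simp add: total_exponent_def)
    also have "\<dots> \<le> B"
      using t component_le_norm_cart[of "total_exponent m0 + t *\<^sub>R axis i 1" i] by linarith
    finally show False
      by (simp add: t_def)
  qed
  then show ?thesis
    unfolding essential_face_on_def using P I ray by blast
qed


section \<open>Dominant monomials along a convergent sequence\<close>

lemma common_convergent_subsequence:
  fixes g :: "'i \<Rightarrow> nat \<Rightarrow> 'b::heine_borel"
  assumes "finite A" "\<And>a. a \<in> A \<Longrightarrow> bounded (range (g a))"
  obtains r :: "nat \<Rightarrow> nat" and l where "strict_mono r" "\<And>a. a \<in> A \<Longrightarrow> (\<lambda>k. g a (r k)) \<longlonglongrightarrow> l a"
proof -
  have "\<exists>r l. strict_mono (r :: nat \<Rightarrow> nat) \<and> (\<forall>a\<in>A. (\<lambda>k. g a (r k)) \<longlonglongrightarrow> l a)"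
    using assms
  proof (induction A rule: finite_induct)
    case empty
    then show ?case using strict_mono_id by auto
  next
    case (insert b A)
    then obtain r :: "nat \<Rightarrow> nat" and l where r: "strict_mono r" "\<forall>a\<in>A. (\<lambda>k. g a (r k)) \<longlonglongrightarrow> l a"
      by (metis insertCI)
    have "bounded (range (\<lambda>k. g b (r k)))"
      using insert.prems[of b] by (rule bounded_subset) auto
    then obtain lb and q :: "nat \<Rightarrow> nat" where q: "strict_mono q" "((\<lambda>k. g b (r k)) \<circ> q) \<longlonglongrightarrow> lb"
      using bounded_imp_convergent_subsequence by metis
    have "(\<lambda>k. g a (r (q k))) \<longlonglongrightarrow> (l(b := lb)) a" if "a \<in> insert b A" for a
    proof (cases "a = b")
      case True
      then show ?thesis using q(2) by (simp add: o_def)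
    next
      case False
      then have "(\<lambda>k. g a (r k)) \<longlonglongrightarrow> l a" using r(2) that by auto
      then show ?thesis using LIMSEQ_subseq_LIMSEQ[OF _ q(1)] False by (fastforce simp: o_def)
    qed
    moreover have "strict_mono (\<lambda>k. r (q k))"
      using strict_mono_o[OF r(1) q(1)] by (simp add: o_def)
    ultimately show ?case by blast
  qed
  with that show thesis by blast
qed

text \<open>Only the components of \<open>L\<close> in the span of \<open>B\<close> are controlled.  They are split off by orthogonal
  projection, which is a continuous function of the numbers \<open>L k \<bullet> b\<close>; the remainder annihilates \<open>B\<close>
  exactly and not only up to a bounded error.\<close>

lemma convergent_orthogonal_part:
  fixes L :: "nat \<Rightarrow> 'a::euclidean_space"
  assumes "\<And>b. b \<in> B \<Longrightarrow> convergent (\<lambda>k. L k \<bullet> b)"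
  obtains x x0 where "x \<longlonglongrightarrow> x0" "\<And>k b. b \<in> B \<Longrightarrow> (L k - x k) \<bullet> b = 0"
proof -
  obtain E where E: "E \<subseteq> span B" "pairwise orthogonal E" "\<And>e. e \<in> E \<Longrightarrow> norm e = 1"
    "independent E" "span E = span B"
    using orthonormal_basis_subspace[OF subspace_span[of B]] by metis
  have "finite E"
    using E(4) independent_imp_finite by blast
  define x where "x k = (\<Sum>e\<in>E. (L k \<bullet> e) *\<^sub>R e)" for k
  have "convergent (\<lambda>k. L k \<bullet> e)" if "e \<in> span B" for e
    using that
  proof (induction rule: span_induct_alt)
    case base
    then show ?case by (simp add: convergent_const)
  next
    case (step c b e)
    have "convergent (\<lambda>k. c * (L k \<bullet> b) + L k \<bullet> e)"
      using step assms by (intro convergent_add convergent_mult convergent_const) auto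
    then show ?case by (simp add: inner_add_right)
  qed
  then have "(\<lambda>k. L k \<bullet> e) \<longlonglongrightarrow> lim (\<lambda>k. L k \<bullet> e)" if "e \<in> E" for e
    using that E(1) convergent_LIMSEQ_iff by blast
  then have "x \<longlonglongrightarrow> (\<Sum>e\<in>E. lim (\<lambda>k. L k \<bullet> e) *\<^sub>R e)"
    unfolding x_def by (intro tendsto_sum tendsto_scaleR tendsto_const)
  moreover have "(L k - x k) \<bullet> b = 0" if "b \<in> B" for k b
  proof -
    have "orthogonal (L k - x k) e" if "e \<in> E" for e
    proof -
      have "x k \<bullet> e = (\<Sum>e'\<in>E. if e' = e then L k \<bullet> e else 0)"
        unfolding x_def inner_sum_left
      proof (rule sum.cong[OF refl])
        fix e' assume "e' \<in> E"
        then show "(L k \<bullet> e') *\<^sub>R e' \<bullet> e = (if e' = e then L k \<bullet> e else 0)"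
          using E(2,3) that by (auto simp: pairwise_def orthogonal_def dot_square_norm)
      qed
      also have "\<dots> = L k \<bullet> e"
        using \<open>finite E\<close> that by simp
      finally show ?thesis
        by (simp add: orthogonal_def inner_diff_left)
    qed
    then have "orthogonal (L k - x k) b"
      using orthogonal_to_span[of b E] E(5) span_base[OF that] by blast
    then show ?thesis by (simp add: orthogonal_def)
  qed
  ultimately show thesis using that by blast
qed

lemma mixed_monom_exp_scale:
  "mixed_monom m (\<chi> i. of_real (exp (- (y $ i))) * s $ i)
    = of_real (exp (- (y \<bullet> total_exponent m))) * mixed_monom m s"
proof -
  have "mixed_monom m (\<chi> i. of_real (exp (- (y $ i))) * s $ i)
      = (\<Prod>i\<in>UNIV. of_real (exp (- (y $ i * total_exponent m $ i)))
          * ((s $ i) ^ fst m i * cnj (s $ i) ^ snd m i))"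
    unfolding mixed_monom_def
  proof (rule prod.cong[OF refl])
    fix i
    have "exp (- (y $ i * total_exponent m $ i)) = exp (- (y $ i)) ^ fst m i * exp (- (y $ i)) ^ snd m i"
      by (simp add: total_exponent_def flip: exp_of_nat_mult exp_add) (simp add: algebra_simps)
    then show "((\<chi> i. of_real (exp (- (y $ i))) * s $ i) $ i) ^ fst m i
        * cnj ((\<chi> i. of_real (exp (- (y $ i))) * s $ i) $ i) ^ snd m i
      = of_real (exp (- (y $ i * total_exponent m $ i))) * ((s $ i) ^ fst m i * cnj (s $ i) ^ snd m i)"
      by (simp add: power_mult_distrib)
  qed
  also have "\<dots> = of_real (\<Prod>i\<in>UNIV. exp (- (y $ i * total_exponent m $ i))) * mixed_monom m s"
    by (simp add: prod.distrib mixed_monom_def)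
  also have "(\<Prod>i\<in>UNIV. exp (- (y $ i * total_exponent m $ i))) = exp (- (y \<bullet> total_exponent m))"
    by (simp add: inner_vec_def sum_negf flip: exp_sum)
  finally show ?thesis .
qed

lemma cmod_mixed_monom:
  assumes "\<And>i. z $ i \<noteq> 0"
  shows "cmod (mixed_monom m z) = exp (- ((\<chi> i. - ln (cmod (z $ i))) \<bullet> total_exponent m))"
proof -
  have "cmod (mixed_monom m z) = (\<Prod>i\<in>UNIV. cmod (z $ i) ^ fst m i * cmod (z $ i) ^ snd m i)"
    by (simp add: mixed_monom_def norm_mult norm_power flip: prod_norm)
  also have "\<dots> = (\<Prod>i\<in>UNIV. exp (ln (cmod (z $ i)) * total_exponent m $ i))"
  proof (rule prod.cong[OF refl])
    fix i
    have "exp (ln (cmod (z $ i)) * real n) = cmod (z $ i) ^ n" for n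
      using assms[of i] exp_of_nat_mult[of n "ln (cmod (z $ i))"] by (simp add: mult.commute)
    then show "cmod (z $ i) ^ fst m i * cmod (z $ i) ^ snd m i
        = exp (ln (cmod (z $ i)) * total_exponent m $ i)"
      by (simp add: total_exponent_def power_add flip: of_nat_add)
  qed
  also have "\<dots> = exp (- ((\<chi> i. - ln (cmod (z $ i))) \<bullet> total_exponent m))"
    by (simp add: inner_vec_def sum_negf flip: exp_sum)
  finally show ?thesis .
qed

lemma tendsto_mixed_monom:
  assumes "(s \<longlongrightarrow> a) F"
  shows "((\<lambda>k. mixed_monom m (s k)) \<longlongrightarrow> mixed_monom m a) F"
  using continuous_polymonial_function[OF polynomial_function_mixed_monom[of m], of a]
    assms isCont_tendsto_compose by blast

text \<open>This lemma takes the place of the curve selection lemma.  Let \<open>L k\<close> be the vector of the numbers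
  \<open>- ln \<bar>z\<^sub>i\<bar>\<close> at \<open>z k\<close>, so that a monomial of exponent \<open>\<xi>\<close> has absolute value \<open>exp (- L k \<bullet> \<xi>)\<close>.
  After passing to a subsequence the monomials of maximal order of growth (relative to \<open>m0\<close>) are
  singled out by \<open>0 < \<rho> m\<close>; for them \<open>L k \<bullet> (\<xi> - \<xi>\<^sub>0)\<close> converges, for all others it tends to infinity.
  Let \<open>x k\<close> be the orthogonal projection of \<open>L k\<close> to the span of the convergent differences and
  of the axes \<open>i\<close> with \<open>w $ i \<noteq> 0\<close>.  It converges, while \<open>y k = L k - x k\<close> is constant on the
  dominant exponents and \<open>0\<close> on these axes; its other coordinates and its excess on the other exponents
  tend to infinity.  Hence \<open>y k\<close> for a single large \<open>k\<close> is the weight \<open>P\<close>, the limit of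
  \<open>exp (- x k)\<close> times the phases of \<open>z k\<close> is the point \<open>a\<close> of the torus, and the scale \<open>c k\<close> is the common factor \<open>exp (- y k \<bullet> \<xi>\<^sub>0)\<close>.\<close>

lemma toric_asymptotics:
  fixes z :: "nat \<Rightarrow> complex ^ 'n::finite"
  assumes z: "z \<longlonglongrightarrow> w" and nz: "\<And>k i. z k $ i \<noteq> 0" and K: "finite K" "K \<noteq> {}"
  obtains r :: "nat \<Rightarrow> nat" and P :: "real ^ 'n" and a c m0 where
    "strict_mono r" "\<And>i. 0 \<le> P $ i" "\<And>i. P $ i = 0 \<longleftrightarrow> w $ i \<noteq> 0"
    "\<And>i. a $ i \<noteq> 0" "\<And>i. w $ i \<noteq> 0 \<Longrightarrow> a $ i = w $ i" "\<And>k. 0 < c k" "m0 \<in> K"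
    "\<And>m. m \<in> K \<Longrightarrow> P \<bullet> total_exponent m0 \<le> P \<bullet> total_exponent m"
    "\<And>m. m \<in> K \<Longrightarrow> (\<lambda>k. mixed_monom m (z (r k)) / of_real (c k))
        \<longlonglongrightarrow> (if P \<bullet> total_exponent m = P \<bullet> total_exponent m0 then mixed_monom m a else 0)"
proof -
  define L where "L k = (\<chi> i. - ln (cmod (z k $ i)))" for k
  have abs_monom: "cmod (mixed_monom m (z k)) = exp (- (L k \<bullet> total_exponent m))" for m k
    unfolding L_def by (rule cmod_mixed_monom) (rule nz)
  define S where "S k = (\<Sum>m\<in>K. cmod (mixed_monom m (z k)))" for k
  have S_pos: "0 < S k" for k
    unfolding S_def using K by (intro sum_pos) (auto simp: abs_monom)
  define ratio where "ratio m k = cmod (mixed_monom m (z k)) / S k" for m k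
  have ratio_bounds: "0 < ratio m k" "ratio m k \<le> 1" if "m \<in> K" for m k
    using S_pos[of k] that K(1) unfolding ratio_def S_def
    by (auto simp: abs_monom divide_le_eq_1 intro!: member_le_sum divide_pos_pos)
  have "bounded (range (ratio m))" if "m \<in> K" for m
    using ratio_bounds[OF that] by (intro boundedI[of _ 1]) (auto simp: abs_of_pos)
  then obtain r1 :: "nat \<Rightarrow> nat" and \<rho> where
    r1: "strict_mono r1" "\<And>m. m \<in> K \<Longrightarrow> (\<lambda>k. ratio m (r1 k)) \<longlonglongrightarrow> \<rho> m"
    using common_convergent_subsequence[OF K(1), of ratio] by blast
  have "bounded (range (\<lambda>k. sgn (z (r1 k) $ i)))" for i
    by (intro boundedI[of _ 1]) (auto simp: norm_sgn)
  then obtain r2 :: "nat \<Rightarrow> nat" and \<sigma> where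
    r2: "strict_mono r2" "\<And>i. (\<lambda>k. sgn (z (r1 (r2 k)) $ i)) \<longlonglongrightarrow> \<sigma> i"
    using common_convergent_subsequence[of UNIV "\<lambda>i k. sgn (z (r1 k) $ i)"] by auto
  define r where "r k = r1 (r2 k)" for k
  have r: "strict_mono r"
    using strict_mono_o[OF r1(1) r2(1)] by (simp add: r_def[abs_def] o_def)
  have sgn_lim: "(\<lambda>k. sgn (z (r k) $ i)) \<longlonglongrightarrow> \<sigma> i" for i
    using r2(2) by (simp add: r_def)
  have ratio_lim: "(\<lambda>k. ratio m (r k)) \<longlonglongrightarrow> \<rho> m" if "m \<in> K" for m
    using LIMSEQ_subseq_LIMSEQ[OF r1(2)[OF that] r2(1)] by (simp add: o_def r_def)
  have zr: "(\<lambda>k. z (r k) $ i) \<longlonglongrightarrow> w $ i" for i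
    using LIMSEQ_subseq_LIMSEQ[OF z r] by (intro tendsto_vec_nth) (simp add: o_def)
  have \<rho>_nonneg: "0 \<le> \<rho> m" if "m \<in> K" for m
    using LIMSEQ_le_const[OF ratio_lim[OF that]] ratio_bounds[OF that] by (auto intro: less_imp_le)
  \<comment> \<open>The limits of the ratios add up to \<open>1\<close>, so one of them is positive.\<close>
  have "(\<lambda>k. \<Sum>m\<in>K. ratio m (r k)) \<longlonglongrightarrow> (\<Sum>m\<in>K. \<rho> m)"
    by (intro tendsto_sum ratio_lim)
  moreover have "(\<Sum>m\<in>K. ratio m (r k)) = 1" for k
    using S_pos[of "r k"] by (simp add: ratio_def S_def flip: sum_divide_distrib)
  ultimately have "(\<Sum>m\<in>K. \<rho> m) = 1"
    by (simp add: LIMSEQ_const_iff)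
  then obtain m0 where m0: "m0 \<in> K" "0 < \<rho> m0"
    using \<rho>_nonneg by (metis less_eq_real_def sum.neutral zero_neq_one)
  have quotient_lim: "(\<lambda>k. exp (- (L (r k) \<bullet> (total_exponent m - total_exponent m0)))) \<longlonglongrightarrow> \<rho> m / \<rho> m0"
    if "m \<in> K" for m
  proof -
    have "exp (- (L (r k) \<bullet> (total_exponent m - total_exponent m0))) = ratio m (r k) / ratio m0 (r k)" for k
      using S_pos[of "r k"] by (simp add: ratio_def abs_monom inner_diff_right flip: exp_diff)
    moreover have "(\<lambda>k. ratio m (r k) / ratio m0 (r k)) \<longlonglongrightarrow> \<rho> m / \<rho> m0"
      using m0 that by (intro tendsto_divide ratio_lim) auto
    ultimately show ?thesis by simp
  qed
  define B where "B = {total_exponent m - total_exponent m0 | m. m \<in> K \<and> 0 < \<rho> m} \<union> {axis i 1 | i. w $ i \<noteq> 0}"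
  have "convergent (\<lambda>k. L (r k) \<bullet> b)" if "b \<in> B" for b
  proof -
    consider m where "m \<in> K" "0 < \<rho> m" "b = total_exponent m - total_exponent m0"
      | i where "w $ i \<noteq> 0" "b = axis i 1"
      using \<open>b \<in> B\<close> unfolding B_def by blast
    then show ?thesis
    proof cases
      case 1
      then have "(\<lambda>k. - ln (exp (- (L (r k) \<bullet> b)))) \<longlonglongrightarrow> - ln (\<rho> m / \<rho> m0)"
        using quotient_lim[of m] m0 by (intro tendsto_minus tendsto_ln) auto
      then show ?thesis by (simp add: convergentI)
    next
      case 2
      then have "(\<lambda>k. - ln (cmod (z (r k) $ i))) \<longlonglongrightarrow> - ln (cmod (w $ i))"
        by (intro tendsto_minus tendsto_ln tendsto_norm zr) auto
      then show ?thesis using 2 by (auto simp: L_def inner_axis intro: convergentI)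
    qed
  qed
  then obtain x x0 where x: "x \<longlonglongrightarrow> x0" and orth: "\<And>k b. b \<in> B \<Longrightarrow> (L (r k) - x k) \<bullet> b = 0"
    using convergent_orthogonal_part[of B "\<lambda>k. L (r k)"] by metis
  define y where "y k = L (r k) - x k" for k
  have y_support: "y k $ i = 0" if "w $ i \<noteq> 0" for k i
    using orth[of "axis i 1" k] that by (auto simp: y_def B_def inner_axis)
  have y_face: "y k \<bullet> (total_exponent m - total_exponent m0) = 0" if "m \<in> K" "0 < \<rho> m" for k m
  proof -
    have "total_exponent m - total_exponent m0 \<in> B"
      unfolding B_def using that by blast
    then show ?thesis using orth by (simp add: y_def)
  qed
  have minus_ln_at_top: "filterlim (\<lambda>k. - ln (g k)) at_top sequentially"
    if "g \<longlonglongrightarrow> 0" "\<And>k. 0 < g k" for g :: "nat \<Rightarrow> real"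
  proof -
    have "filterlim g (at_right 0) sequentially"
      using that by (intro tendsto_imp_filterlim_at_right) auto
    then have "filterlim (\<lambda>k. ln (g k)) at_bot sequentially"
      by (rule filterlim_compose[OF ln_at_0])
    then show ?thesis by (simp add: filterlim_uminus_at_bot)
  qed
  have y_top: "filterlim (\<lambda>k. y k $ i) at_top sequentially" if "w $ i = 0" for i
  proof -
    have "(\<lambda>k. cmod (z (r k) $ i)) \<longlonglongrightarrow> 0"
      using tendsto_norm[OF zr[of i]] that by simp
    then have "filterlim (\<lambda>k. L (r k) $ i) at_top sequentially"
      using minus_ln_at_top nz by (simp add: L_def)
    moreover have "(\<lambda>k. - (x k $ i)) \<longlonglongrightarrow> - (x0 $ i)"
      by (intro tendsto_minus tendsto_vec_nth x)
    ultimately have "filterlim (\<lambda>k. - (x k $ i) + L (r k) $ i) at_top sequentially"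
      by (intro filterlim_tendsto_add_at_top)
    then show ?thesis by (simp add: y_def)
  qed
  have y_off_face: "filterlim (\<lambda>k. y k \<bullet> (total_exponent m - total_exponent m0)) at_top sequentially"
    if "m \<in> K" "\<not> 0 < \<rho> m" for m
  proof -
    let ?b = "total_exponent m - total_exponent m0"
    have "\<rho> m = 0"
      using \<rho>_nonneg[OF that(1)] that(2) by linarith
    then have "filterlim (\<lambda>k. L (r k) \<bullet> ?b) at_top sequentially"
      using minus_ln_at_top[of "\<lambda>k. exp (- (L (r k) \<bullet> ?b))"] quotient_lim[OF that(1)] by simp
    moreover have "(\<lambda>k. - (x k \<bullet> ?b)) \<longlonglongrightarrow> - (x0 \<bullet> ?b)"
      by (intro tendsto_minus tendsto_inner x tendsto_const)
    ultimately have "filterlim (\<lambda>k. - (x k \<bullet> ?b) + L (r k) \<bullet> ?b) at_top sequentially"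
      by (intro filterlim_tendsto_add_at_top)
    then show ?thesis by (simp add: y_def inner_diff_left)
  qed
  have "eventually (\<lambda>k. \<forall>i\<in>{i. w $ i = 0}. 0 < y k $ i) sequentially"
    by (intro eventually_ball_finite) (auto simp: filterlim_at_top_dense dest!: y_top)
  moreover have "eventually (\<lambda>k. \<forall>m\<in>{m \<in> K. \<not> 0 < \<rho> m}. 0 < y k \<bullet> (total_exponent m - total_exponent m0)) sequentially"
    using K(1) y_off_face by (intro eventually_ball_finite) (auto simp: filterlim_at_top_dense)
  ultimately have "eventually (\<lambda>k. (\<forall>i\<in>{i. w $ i = 0}. 0 < y k $ i)
      \<and> (\<forall>m\<in>{m \<in> K. \<not> 0 < \<rho> m}. 0 < y k \<bullet> (total_exponent m - total_exponent m0))) sequentially"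
    by (rule eventually_conj)
  then obtain k0 where k0: "\<And>i. w $ i = 0 \<Longrightarrow> 0 < y k0 $ i"
    "\<And>m. m \<in> K \<Longrightarrow> \<not> 0 < \<rho> m \<Longrightarrow> 0 < y k0 \<bullet> (total_exponent m - total_exponent m0)"
    unfolding eventually_sequentially by blast
  define P where "P = y k0"
  have P_on_keys: "P \<bullet> total_exponent m0 \<le> P \<bullet> total_exponent m"
    "P \<bullet> total_exponent m = P \<bullet> total_exponent m0 \<longleftrightarrow> 0 < \<rho> m" if "m \<in> K" for m
    using y_face[OF that] k0(2)[OF that] unfolding P_def
    by (cases "0 < \<rho> m"; force simp: inner_diff_right)+
  define s where "s k = (\<chi> i. of_real (exp (- (x k $ i))) * sgn (z (r k) $ i))" for k
  define a where "a = (\<chi> i. of_real (exp (- (x0 $ i))) * \<sigma> i)"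
  have s_lim: "s \<longlonglongrightarrow> a"
    unfolding s_def a_def
    by (intro vec_tendstoI) (auto intro!: tendsto_intros sgn_lim x)
  have z_eq: "z (r k) = (\<chi> i. of_real (exp (- (y k $ i))) * s k $ i)" for k
  proof (rule vec_eq_iff[THEN iffD2], rule allI)
    fix i
    have "of_real (exp (- (y k $ i))) * s k $ i = of_real (exp (- (L (r k) $ i))) * sgn (z (r k) $ i)"
      by (simp add: s_def y_def flip: of_real_mult exp_add mult.assoc)
    also have "\<dots> = z (r k) $ i"
      using nz[of "r k" i] by (simp add: L_def sgn_eq)
    finally show "z (r k) $ i = (\<chi> i. of_real (exp (- (y k $ i))) * s k $ i) $ i" by simp
  qed
  define c where "c k = exp (- (y k \<bullet> total_exponent m0))" for k
  have scaled: "mixed_monom m (z (r k)) / of_real (c k)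
      = of_real (exp (- (y k \<bullet> (total_exponent m - total_exponent m0)))) * mixed_monom m (s k)" for m k
  proof -
    have "mixed_monom m (z (r k)) = of_real (exp (- (y k \<bullet> total_exponent m))) * mixed_monom m (s k)"
      by (subst z_eq) (rule mixed_monom_exp_scale)
    moreover have "exp (- (y k \<bullet> (total_exponent m - total_exponent m0))) = exp (- (y k \<bullet> total_exponent m)) / c k"
      by (simp add: c_def inner_diff_right flip: exp_diff)
    ultimately show ?thesis by simp
  qed
  show thesis
  proof (rule that[of r P a c m0])
    show "0 \<le> P $ i" "P $ i = 0 \<longleftrightarrow> w $ i \<noteq> 0" for i
      using y_support[of i k0] k0(1)[of i] by (cases "w $ i = 0"; force simp: P_def)+
    show "a $ i \<noteq> 0" for i
    proof -
      have "(\<lambda>k. cmod (sgn (z (r k) $ i))) \<longlonglongrightarrow> cmod (\<sigma> i)"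
        by (intro tendsto_norm sgn_lim)
      then have "cmod (\<sigma> i) = 1"
        by (simp add: norm_sgn nz LIMSEQ_const_iff)
      then show ?thesis by (auto simp: a_def)
    qed
    show "a $ i = w $ i" if "w $ i \<noteq> 0" for i
    proof -
      have "z (r k) $ i = s k $ i" for k
        using y_support[OF that, of k] by (simp add: z_eq)
      then have "(\<lambda>k. z (r k) $ i) \<longlonglongrightarrow> a $ i"
        using tendsto_vec_nth[OF s_lim, of i] by simp
      then show ?thesis
        using zr LIMSEQ_unique by blast
    qed
    show "(\<lambda>k. mixed_monom m (z (r k)) / of_real (c k))
        \<longlonglongrightarrow> (if P \<bullet> total_exponent m = P \<bullet> total_exponent m0 then mixed_monom m a else 0)" if "m \<in> K" for m
    proof (cases "0 < \<rho> m")
      case True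
      then show ?thesis
        using that by (simp add: P_on_keys(2) scaled y_face tendsto_mixed_monom s_lim)
    next
      case False
      have "(\<lambda>k. exp (- (y k \<bullet> (total_exponent m - total_exponent m0)))) \<longlonglongrightarrow> 0"
        using y_off_face[OF that False]
        by (intro filterlim_compose[OF exp_at_bot]) (simp add: filterlim_uminus_at_bot)
      then have "(\<lambda>k. of_real (exp (- (y k \<bullet> (total_exponent m - total_exponent m0)))) * mixed_monom m (s k))
          \<longlonglongrightarrow> of_real 0 * mixed_monom m a"
        by (intro tendsto_mult tendsto_of_real tendsto_mixed_monom s_lim)
      then show ?thesis
        using that False by (simp add: P_on_keys(2) scaled)
    qed
  qed (use r m0 P_on_keys in \<open>auto simp: c_def\<close>)
qed

text \<open>Points with vanishing coordinates are reduced to points of the torus by a perturbation so small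
  that it changes every monomial only by a vanishing fraction of the sum of all absolute values.\<close>

lemma monomial_asymptotics:
  fixes z :: "nat \<Rightarrow> complex ^ 'n::finite"
  assumes z: "z \<longlonglongrightarrow> w" and K: "finite K" and nz: "\<And>k. \<exists>m\<in>K. mixed_monom m (z k) \<noteq> 0"
  obtains r :: "nat \<Rightarrow> nat" and P :: "real ^ 'n" and a c m0 where
    "strict_mono r" "\<And>i. 0 \<le> P $ i" "\<And>i. P $ i = 0 \<longleftrightarrow> w $ i \<noteq> 0"
    "\<And>i. a $ i \<noteq> 0" "\<And>i. w $ i \<noteq> 0 \<Longrightarrow> a $ i = w $ i" "\<And>k. 0 < c k" "m0 \<in> K"
    "\<And>m. m \<in> K \<Longrightarrow> P \<bullet> total_exponent m0 \<le> P \<bullet> total_exponent m"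
    "\<And>m. m \<in> K \<Longrightarrow> (\<lambda>k. mixed_monom m (z (r k)) / of_real (c k))
        \<longlonglongrightarrow> (if P \<bullet> total_exponent m = P \<bullet> total_exponent m0 then mixed_monom m a else 0)"
proof -
  define S where "S x = (\<Sum>m\<in>K. cmod (mixed_monom m x))" for x :: "complex ^ 'n"
  have S_pos: "0 < S (z k)" for k
    using nz[of k] K unfolding S_def by (auto intro!: sum_pos2)
  have "\<exists>x. (\<forall>i. x $ i \<noteq> 0) \<and> dist x (z k) < 1 / (real k + 1) \<and>
      (\<forall>m\<in>K. dist (mixed_monom m x) (mixed_monom m (z k)) < S (z k) / (real k + 1))" for k
  proof -
    define p where "p t = (\<chi> i. z k $ i + (if z k $ i = 0 then of_real t else 0))" for t :: real
    have p: "(p \<longlongrightarrow> z k) (at_right 0)"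
    proof (rule vec_tendstoI)
      fix i
      have "((\<lambda>t. complex_of_real t) \<longlongrightarrow> of_real 0) (at_right 0)"
        by (intro tendsto_of_real tendsto_ident_at)
      then show "((\<lambda>t. p t $ i) \<longlongrightarrow> z k $ i) (at_right 0)"
        by (cases "z k $ i = 0") (simp_all add: p_def)
    qed
    have "\<forall>\<^sub>F t in at_right 0. 0 < t \<and> dist (p t) (z k) < 1 / (real k + 1) \<and>
        (\<forall>m\<in>K. dist (mixed_monom m (p t)) (mixed_monom m (z k)) < S (z k) / (real k + 1))"
      using K S_pos[of k]
      by (intro eventually_conj eventually_ball_finite ballI tendstoD[OF p]
          tendstoD[OF tendsto_mixed_monom[OF p]] eventually_at_right_less) auto
    then obtain t where "0 < t" and t: "dist (p t) (z k) < 1 / (real k + 1)"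
        "\<forall>m\<in>K. dist (mixed_monom m (p t)) (mixed_monom m (z k)) < S (z k) / (real k + 1)"
      using eventually_happens trivial_limit_at_right_real by blast
    have "p t $ i \<noteq> 0" for i
      using \<open>0 < t\<close> by (simp add: p_def)
    with t show ?thesis by blast
  qed
  then obtain z' where z': "\<And>k i. z' k $ i \<noteq> 0" "\<And>k. dist (z' k) (z k) < 1 / (real k + 1)"
      "\<And>k m. m \<in> K \<Longrightarrow> dist (mixed_monom m (z' k)) (mixed_monom m (z k)) < S (z k) / (real k + 1)"
    by metis
  have inverse_null: "(\<lambda>k. 1 / (real k + 1)) \<longlonglongrightarrow> 0"
    using LIMSEQ_inverse_real_of_nat by (simp add: inverse_eq_divide add.commute)
  have "(\<lambda>k. z' k - z k) \<longlonglongrightarrow> 0"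
    using z'(2) by (intro Lim_null_comparison[OF _ inverse_null]) (auto simp: dist_norm less_imp_le)
  from tendsto_add[OF this z] have "z' \<longlonglongrightarrow> w" by simp
  moreover have "K \<noteq> {}"
    using nz by blast
  ultimately obtain r :: "nat \<Rightarrow> nat" and P :: "real ^ 'n" and a c m0 where
    r: "strict_mono r" and P: "\<And>i. 0 \<le> P $ i" "\<And>i. P $ i = 0 \<longleftrightarrow> w $ i \<noteq> 0" and
    a: "\<And>i. a $ i \<noteq> 0" "\<And>i. w $ i \<noteq> 0 \<Longrightarrow> a $ i = w $ i" and c: "\<And>k. 0 < c k" and m0: "m0 \<in> K"
    "\<And>m. m \<in> K \<Longrightarrow> P \<bullet> total_exponent m0 \<le> P \<bullet> total_exponent m" and
    lim: "\<And>m. m \<in> K \<Longrightarrow> (\<lambda>k. mixed_monom m (z' (r k)) / of_real (c k))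
        \<longlonglongrightarrow> (if P \<bullet> total_exponent m = P \<bullet> total_exponent m0 then mixed_monom m a else 0)"
    using toric_asymptotics[of z' w K] z'(1) K by blast
  \<comment> \<open>The perturbed monomials also dominate the size of the original ones.\<close>
  have S_le: "S (z k) \<le> 2 * S (z' k)" if k: "2 * real (card K) \<le> real k + 1" for k
  proof -
    have "S (z k) \<le> (\<Sum>m\<in>K. cmod (mixed_monom m (z' k)) + S (z k) / (real k + 1))"
      unfolding S_def[of "z k"]
    proof (rule sum_mono)
      fix m assume "m \<in> K"
      then show "cmod (mixed_monom m (z k)) \<le> cmod (mixed_monom m (z' k))
          + (\<Sum>m\<in>K. cmod (mixed_monom m (z k))) / (real k + 1)"
        using z'(3)[of m k] norm_triangle_sub[of "mixed_monom m (z k)" "mixed_monom m (z' k)"]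
        by (simp add: dist_norm norm_minus_commute S_def)
    qed
    also have "\<dots> = S (z' k) + real (card K) * (S (z k) / (real k + 1))"
      by (simp add: sum.distrib S_def)
    also have "real (card K) * (S (z k) / (real k + 1)) \<le> S (z k) / 2"
      using mult_right_mono[OF k, of "S (z k)"] S_pos[of k] by (simp add: field_simps)
    finally show ?thesis by simp
  qed
  have "(\<lambda>k. 2 * (\<Sum>m\<in>K. cmod (mixed_monom m (z' (r k)) / of_real (c k))) * (1 / (real k + 1))) \<longlonglongrightarrow>
      2 * (\<Sum>m\<in>K. cmod (if P \<bullet> total_exponent m = P \<bullet> total_exponent m0 then mixed_monom m a else 0)) * 0"
    by (intro tendsto_mult tendsto_const tendsto_sum tendsto_norm lim inverse_null)
  then have bound_null: "(\<lambda>k. 2 * (S (z' (r k)) / c k) * (1 / (real k + 1))) \<longlonglongrightarrow> 0"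
    using c by (simp add: S_def norm_divide sum_divide_distrib less_imp_le abs_of_pos)
  have "(\<lambda>k. mixed_monom m (z (r k)) / of_real (c k))
      \<longlonglongrightarrow> (if P \<bullet> total_exponent m = P \<bullet> total_exponent m0 then mixed_monom m a else 0)" if "m \<in> K" for m
  proof -
    have "norm (mixed_monom m (z (r k)) / of_real (c k) - mixed_monom m (z' (r k)) / of_real (c k))
        \<le> 2 * (S (z' (r k)) / c k) * (1 / (real k + 1))" if k: "nat \<lceil>2 * real (card K)\<rceil> \<le> k" for k
    proof -
      have "k \<le> r k"
        using r by (rule seq_suble)
      have "norm (mixed_monom m (z (r k)) / of_real (c k) - mixed_monom m (z' (r k)) / of_real (c k))
          = dist (mixed_monom m (z' (r k))) (mixed_monom m (z (r k))) / c k"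
        using c[of k] by (simp add: dist_norm norm_minus_commute norm_divide flip: diff_divide_distrib)
      also have "\<dots> \<le> (S (z (r k)) / (real (r k) + 1)) / c k"
        using z'(3)[OF \<open>m \<in> K\<close>, of "r k"] c[of k] by (intro divide_right_mono) auto
      also have "\<dots> \<le> (2 * S (z' (r k)) / (real k + 1)) / c k"
        using S_le[of "r k"] S_pos[of "r k"] k \<open>k \<le> r k\<close> c[of k]
        by (intro divide_right_mono frac_le) linarith+
      finally show ?thesis by (simp add: field_simps)
    qed
    then have "(\<lambda>k. mixed_monom m (z (r k)) / of_real (c k) - mixed_monom m (z' (r k)) / of_real (c k)) \<longlonglongrightarrow> 0"
      by (rule Lim_null_comparison[OF eventually_sequentiallyI bound_null])
    from tendsto_add[OF this lim[OF that]] show ?thesis by simp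
  qed
  with r P a c m0 that show thesis by blast
qed

text \<open>Differentiation in directions \<open>z * u\<close> multiplies each monomial by a factor that does not depend on
  \<open>z\<close>, so differentials inherit the asymptotics of the monomials: after rescaling, the differential of
  \<open>f\<close> tends to that of a face function.\<close>

lemma frechet_derivative_asymptotics:
  fixes z :: "nat \<Rightarrow> complex ^ 'n::finite"
  assumes K: "finite K" "D \<subseteq> K"
    and lim: "\<And>m. m \<in> K \<Longrightarrow> (\<lambda>k. mixed_monom m (z k) / of_real (c k)) \<longlonglongrightarrow> (if m \<in> D then mixed_monom m a else 0)"
    and u: "u \<longlonglongrightarrow> u0"
  shows "(\<lambda>k. frechet_derivative (mixed_sum h K) (at (z k)) (z k * u k) / of_real (c k))
    \<longlonglongrightarrow> frechet_derivative (mixed_sum h D) (at a) (a * u0)"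
proof -
  have weight: "(\<lambda>k. log_weight m (u k)) \<longlonglongrightarrow> log_weight m u0" for m
    unfolding log_weight_def by (intro tendsto_intros u)
  have "(\<lambda>k. \<Sum>m\<in>K. h m * (mixed_monom m (z k) / of_real (c k)) * log_weight m (u k)) \<longlonglongrightarrow>
      (\<Sum>m\<in>K. h m * (if m \<in> D then mixed_monom m a else 0) * log_weight m u0)"
    by (intro tendsto_sum tendsto_mult tendsto_const lim weight)
  also have "(\<Sum>m\<in>K. h m * (if m \<in> D then mixed_monom m a else 0) * log_weight m u0)
      = (\<Sum>m\<in>D. h m * mixed_monom m a * log_weight m u0)"
    using K by (intro sum.mono_neutral_cong_right) auto
  also have "\<dots> = frechet_derivative (mixed_sum h D) (at a) (a * u0)"
    by (rule frechet_derivative_mixed_sum[OF finite_subset[OF K(2,1)], symmetric])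
  finally show ?thesis
    by (simp add: frechet_derivative_mixed_sum[OF K(1)] sum_divide_distrib)
qed


section \<open>Submersivity near the origin\<close>

text \<open>Cramer's rule for two real unknowns.  The explicit coefficients depend continuously on
  \<open>\<alpha>\<close>, \<open>\<beta>\<close> and \<open>\<gamma>\<close>.\<close>

lemma real_combination_of_complex:
  assumes "Im (cnj \<alpha> * \<beta>) \<noteq> 0"
  shows "of_real (Im (cnj \<gamma> * \<beta>) / Im (cnj \<alpha> * \<beta>)) * \<alpha>
    + of_real (Im (cnj \<alpha> * \<gamma>) / Im (cnj \<alpha> * \<beta>)) * \<beta> = \<gamma>"
proof -
  have "of_real (Im (cnj \<gamma> * \<beta>)) * \<alpha> + of_real (Im (cnj \<alpha> * \<gamma>)) * \<beta> = of_real (Im (cnj \<alpha> * \<beta>)) * \<gamma>"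
    by (simp add: complex_eq_iff algebra_simps)
  moreover have "complex_of_real (Im (cnj \<alpha> * \<beta>)) \<noteq> 0"
    using assms by (simp only: of_real_eq_0_iff not_False_eq_True)
  ultimately have "(of_real (Im (cnj \<gamma> * \<beta>)) * \<alpha> + of_real (Im (cnj \<alpha> * \<gamma>)) * \<beta>)
      / of_real (Im (cnj \<alpha> * \<beta>)) = \<gamma>"
    by (metis nonzero_mult_div_cancel_left)
  then show ?thesis
    by (simp only: add_divide_distrib of_real_divide times_divide_eq_left)
qed

lemma mixed_monom_nonzero_iff:
  "mixed_monom m z \<noteq> 0 \<longleftrightarrow> (\<forall>i. z $ i = 0 \<longrightarrow> fst m i = 0 \<and> snd m i = 0)"
  by (auto simp: mixed_monom_def)

text \<open>The vectors \<open>z * u\<close> form the coordinate subspace \<open>\<complex>\<^sup>I\<close> in which \<open>z\<close> has only nonzero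
  coordinates, so this says that \<open>z\<close> is not a critical point of the restriction \<open>f\<^sup>I\<close>.\<close>

definition torus_submersive :: "(complex ^ 'n::finite \<Rightarrow> complex) \<Rightarrow> complex ^ 'n \<Rightarrow> bool" where
  "torus_submersive f z \<longleftrightarrow> range (\<lambda>u. frechet_derivative f (at z) (z * u)) = UNIV"

lemma linear_frechet_derivative_mixed_sum: "linear (frechet_derivative (mixed_sum h D) (at z))"
  using mixed_sum_has_derivative has_derivative_linear by blast

text \<open>Otherwise there is a sequence of exceptions tending to \<open>0\<close>.  All coordinates tend to \<open>0\<close>, so the
  weight that governs it is strictly positive and its face \<open>\<Delta>\<close> is compact.  The rescaled
  differentials tend to that of \<open>f\<^sub>\<Delta>\<close> at a point of the torus, which is onto by strong non-degeneracy,
  and being onto is an open condition.\<close>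

lemma torus_submersive_near_origin:
  assumes "strongly_nondegenerate f"
  obtains r where "0 < r"
    "\<And>z. \<lbrakk>z \<in> cball 0 r; \<exists>m\<in>Poly_Mapping.keys f. mixed_monom m z \<noteq> 0\<rbrakk> \<Longrightarrow> torus_submersive (mixed_eval f) z"
proof (rule ccontr)
  assume contr: "\<not> thesis"
  define h where "h = Poly_Mapping.lookup f"
  define K where "K = Poly_Mapping.keys f"
  have f: "mixed_eval f = mixed_sum h K"
    by (simp add: mixed_eval_eq_mixed_sum h_def K_def)
  have "\<exists>z. z \<in> cball 0 (1 / (real k + 1)) \<and> (\<exists>m\<in>K. mixed_monom m z \<noteq> 0) \<and> \<not> torus_submersive (mixed_sum h K) z" for k
  proof (rule ccontr)
    assume "\<not> ?thesis"
    then show False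
      using contr that[of "1 / (real k + 1)", folded K_def, unfolded f] by auto
  qed
  then obtain z where z: "\<And>k. z k \<in> cball 0 (1 / (real k + 1))" "\<And>k. \<exists>m\<in>K. mixed_monom m (z k) \<noteq> 0"
    "\<And>k. \<not> torus_submersive (mixed_sum h K) (z k)"
    by metis
  have "(\<lambda>k. 1 / (real k + 1)) \<longlonglongrightarrow> 0"
    using LIMSEQ_inverse_real_of_nat by (simp add: inverse_eq_divide add.commute)
  then have z_lim: "z \<longlonglongrightarrow> 0"
    using z(1) by (intro Lim_null_comparison[of z]) auto
  have K: "finite K"
    by (simp add: K_def)
  obtain r :: "nat \<Rightarrow> nat" and P :: "real ^ 'a" and a c m0 where "strict_mono r" and
    P: "\<And>i. 0 \<le> P $ i" "\<And>i. P $ i = 0 \<longleftrightarrow> (0 :: complex ^ 'a) $ i \<noteq> 0" and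
    a: "\<And>i. a $ i \<noteq> 0" "\<And>i. (0 :: complex ^ 'a) $ i \<noteq> 0 \<Longrightarrow> a $ i = 0 $ i" and c: "\<And>k. 0 < c k" and m0: "m0 \<in> K"
    "\<And>m. m \<in> K \<Longrightarrow> P \<bullet> total_exponent m0 \<le> P \<bullet> total_exponent m" and
    lim: "\<And>m. m \<in> K \<Longrightarrow> (\<lambda>k. mixed_monom m (z (r k)) / of_real (c k))
        \<longlonglongrightarrow> (if P \<bullet> total_exponent m = P \<bullet> total_exponent m0 then mixed_monom m a else 0)"
    using monomial_asymptotics[OF z_lim K z(2)] by blast
  have P_pos: "0 < P $ i" for i
    using P[of i] by (simp add: less_le)
  define \<Delta> where "\<Delta> = weight_face f P"
  have face: "compact_face f \<Delta>"
    unfolding \<Delta>_def using P_pos m0 by (intro compact_face_weight_face[of P m0]) (auto simp: K_def)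
  define D where "D = face_keys f \<Delta>"
  have D: "D = {m \<in> K. P \<bullet> total_exponent m = P \<bullet> total_exponent m0}"
    unfolding D_def \<Delta>_def using P m0 by (subst face_keys_weight_face[of P m0]) (auto simp: K_def)
  have "\<Delta> \<subseteq> newton_boundary_nc f"
    using face by (auto simp: newton_boundary_nc_def newton_boundary_def)
  then have "\<not> critical_point (mixed_sum h D) a"
    using assms face a unfolding strongly_nondegenerate_def D_def h_def
    by (auto simp: coord_torus_def coord_subspace_def face_fun_eq_mixed_sum)
  then have surj: "range (frechet_derivative (mixed_sum h D) (at a)) = UNIV"
    using not_critical_point_iff differentiableI[OF mixed_sum_has_derivative] by blast
  obtain b1 b2 where b: "frechet_derivative (mixed_sum h D) (at a) b1 = 1"
      "frechet_derivative (mixed_sum h D) (at a) b2 = \<i>"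
    using surj by (metis UNIV_I image_iff)
  define u where "u b = (\<chi> i. b $ i / a $ i)" for b :: "complex ^ 'a"
  have au: "a * u b = b" for b
    using a by (simp add: vec_eq_iff u_def)
  define \<alpha> where "\<alpha> b k = frechet_derivative (mixed_sum h K) (at (z (r k))) (z (r k) * u b) / of_real (c k)" for b k
  have "\<alpha> b \<longlonglongrightarrow> frechet_derivative (mixed_sum h D) (at a) b" for b
  proof -
    have "(\<lambda>k. mixed_monom m (z (r k)) / of_real (c k)) \<longlonglongrightarrow> (if m \<in> D then mixed_monom m a else 0)"
      if "m \<in> K" for m
      using lim[OF that] that by (simp add: D)
    then show ?thesis
      using frechet_derivative_asymptotics[OF K, of D "\<lambda>k. z (r k)" c a "\<lambda>_. u b" "u b" h]
      by (simp add: \<alpha>_def[abs_def] au D)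
  qed
  then have "(\<lambda>k. Im (cnj (\<alpha> b1 k) * \<alpha> b2 k)) \<longlonglongrightarrow> Im (cnj 1 * \<i>)"
    using b by (intro tendsto_intros) metis+
  then have "eventually (\<lambda>k. Im (cnj (\<alpha> b1 k) * \<alpha> b2 k) \<noteq> 0) sequentially"
    by (rule tendsto_imp_eventually_ne) simp
  then obtain k where k: "Im (cnj (\<alpha> b1 k) * \<alpha> b2 k) \<noteq> 0"
    unfolding eventually_sequentially by blast
  have "y \<in> range (\<lambda>u. frechet_derivative (mixed_sum h K) (at (z (r k))) (z (r k) * u))" for y
  proof -
    let ?A = "frechet_derivative (mixed_sum h K) (at (z (r k)))"
    obtain s t :: real where "of_real s * \<alpha> b1 k + of_real t * \<alpha> b2 k = y / of_real (c k)"
      using real_combination_of_complex[OF k] by blast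
    then have "y = of_real s * ?A (z (r k) * u b1) + of_real t * ?A (z (r k) * u b2)"
      using c[of k] by (simp add: \<alpha>_def field_simps)
    also have "\<dots> = ?A (s *\<^sub>R (z (r k) * u b1) + t *\<^sub>R (z (r k) * u b2))"
      using linear_frechet_derivative_mixed_sum[of h K "z (r k)"]
      by (simp add: linear_add linear_scale scaleR_conv_of_real[where 'a = complex])
    also have "s *\<^sub>R (z (r k) * u b1) + t *\<^sub>R (z (r k) * u b2) = z (r k) * (s *\<^sub>R u b1 + t *\<^sub>R u b2)"
      by (simp add: vec_eq_iff algebra_simps)
    finally show ?thesis by blast
  qed
  then have "torus_submersive (mixed_sum h K) (z (r k))"
    unfolding torus_submersive_def by blast
  with z(3) show False by blast
qed


section \<open>Smoothness of the canonical strata\<close>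

lemma coord_torus_iff_support: "z \<in> coord_torus I \<longleftrightarrow> {i. z $ i \<noteq> 0} = I"
  by (auto simp: coord_torus_def coord_subspace_def)

lemma nonzero_monomial_of_mixed_eval:
  assumes "mixed_eval f z \<noteq> 0"
  shows "\<exists>m\<in>Poly_Mapping.keys f. mixed_monom m z \<noteq> 0"
proof (rule ccontr)
  assume "\<not> ?thesis"
  then have "mixed_eval f z = 0"
    unfolding mixed_eval_def by (intro sum.neutral) auto
  with assms show False by simp
qed

lemma nonzero_monomial_of_nonvanishing:
  assumes "I \<in> nonvanishing_sets f" "z \<in> coord_torus I"
  shows "\<exists>m\<in>Poly_Mapping.keys f. mixed_monom m z \<noteq> 0"
proof -
  obtain x where x: "x \<in> coord_subspace I" "mixed_eval f x \<noteq> 0"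
    using assms(1) by (auto simp: nonvanishing_sets_def)
  then obtain m where m: "m \<in> Poly_Mapping.keys f" "mixed_monom m x \<noteq> 0"
    using nonzero_monomial_of_mixed_eval by blast
  have "mixed_monom m z \<noteq> 0"
    using m(2) x(1) assms(2)
    by (auto simp: mixed_monom_nonzero_iff coord_torus_def coord_subspace_def)
  with m(1) show ?thesis by blast
qed

lemma vanishing_iff_not_nonvanishing: "I \<in> vanishing_sets f \<longleftrightarrow> I \<notin> nonvanishing_sets f"
  by (auto simp: vanishing_sets_def nonvanishing_sets_def)

definition canonical_stratum :: "'n::finite mixed_poly \<Rightarrow> complex ^ 'n \<Rightarrow> (complex ^ 'n) set" where
  "canonical_stratum f x =
    (let I = {i. x $ i \<noteq> 0}; V = mixed_eval f -` {0} in
      if I \<in> vanishing_sets f then coord_torus I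
      else if x \<in> V then V \<inter> coord_torus I
      else coord_torus I - (V \<inter> coord_subspace I))"

lemma mem_canonical_stratification_iff:
  "M \<in> canonical_stratification f \<longleftrightarrow>
    (\<exists>I\<in>nonvanishing_sets f. M = mixed_eval f -` {0} \<inter> coord_torus I) \<or>
    (\<exists>I\<in>nonvanishing_sets f. M = coord_torus I - (mixed_eval f -` {0} \<inter> coord_subspace I)) \<or>
    (\<exists>I\<in>vanishing_sets f. M = coord_torus I)"
proof -
  have "M \<in> {coord_torus I |I. I \<in> vanishing_sets f} \<longleftrightarrow> (\<exists>I\<in>vanishing_sets f. M = coord_torus I)"
    by blast
  then show ?thesis
    by (simp add: canonical_stratification_def Let_def bex_disj_distrib)
qed

lemma canonical_stratum_unique:
  assumes "M \<in> canonical_stratification f" "x \<in> M"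
  shows "M = canonical_stratum f x"
proof -
  let ?V = "mixed_eval f -` {0}"
  consider I where "I \<in> nonvanishing_sets f" "M = ?V \<inter> coord_torus I"
    | I where "I \<in> nonvanishing_sets f" "M = coord_torus I - (?V \<inter> coord_subspace I)"
    | I where "I \<in> vanishing_sets f" "M = coord_torus I"
    using assms(1) unfolding mem_canonical_stratification_iff by (elim disjE bexE)
  then show ?thesis
  proof cases
    case (1 I)
    then have "{i. x $ i \<noteq> 0} = I"
      using assms(2) coord_torus_iff_support by blast
    with 1 assms(2) show ?thesis
      by (simp add: canonical_stratum_def vanishing_iff_not_nonvanishing)
  next
    case (2 I)
    then have "{i. x $ i \<noteq> 0} = I" "x \<in> coord_subspace I"
      using assms(2) coord_torus_iff_support by (blast, simp add: coord_torus_def)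
    with 2 assms(2) show ?thesis
      by (simp add: canonical_stratum_def vanishing_iff_not_nonvanishing)
  next
    case (3 I)
    then have "{i. x $ i \<noteq> 0} = I"
      using assms(2) coord_torus_iff_support by blast
    with 3 show ?thesis
      by (simp add: canonical_stratum_def)
  qed
qed

lemma canonical_stratum_in_stratification: "canonical_stratum f x \<in> canonical_stratification f"
proof -
  define I where "I = {i. x $ i \<noteq> 0}"
  consider "I \<in> vanishing_sets f" "canonical_stratum f x = coord_torus I"
    | "I \<in> nonvanishing_sets f" "canonical_stratum f x = mixed_eval f -` {0} \<inter> coord_torus I"
    | "I \<in> nonvanishing_sets f"
      "canonical_stratum f x = coord_torus I - (mixed_eval f -` {0} \<inter> coord_subspace I)"
    unfolding canonical_stratum_def Let_def vanishing_iff_not_nonvanishing I_def by meson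
  then show ?thesis
    unfolding mem_canonical_stratification_iff by cases blast+
qed

lemma mem_canonical_stratum: "x \<in> canonical_stratum f x"
  by (simp add: canonical_stratum_def Let_def coord_torus_iff_support)

lemma canonical_stratum_subset_zero_set:
  assumes "mixed_eval f x = 0"
  shows "canonical_stratum f x \<subseteq> mixed_eval f -` {0}"
  using assms by (auto simp: canonical_stratum_def Let_def vanishing_sets_def coord_torus_def)

definition coord_projection :: "'n::finite set \<Rightarrow> complex ^ 'n \<Rightarrow> complex ^ 'n" where
  "coord_projection J x = (\<chi> j. if j \<in> J then x $ j else 0)"

lemma bounded_linear_coord_projection: "bounded_linear (coord_projection J)"
  by (intro linear_conv_bounded_linear[THEN iffD1] linearI) (auto simp: coord_projection_def vec_eq_iff)

lemma open_nonzero_coords: "open {x :: complex ^ 'n::finite. \<forall>j\<in>I. x $ j \<noteq> 0}"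
proof -
  have "{x :: complex ^ 'n. \<forall>j\<in>I. x $ j \<noteq> 0} = (\<Inter>j\<in>I. {x. x $ j \<noteq> 0})"
    by auto
  also have "open \<dots>"
    by (intro open_INT ballI open_Collect_neq linear_continuous_on[OF bounded_linear_vec_nth]
        continuous_on_const) auto
  finally show ?thesis .
qed

lemma smooth_submanifold_at_open_in_coord_subspace:
  assumes "open U" "w \<in> U" "M \<inter> U = coord_subspace I \<inter> U"
  shows "smooth_submanifold_at M w"
  unfolding smooth_submanifold_at_def
proof (intro exI conjI)
  let ?g = "coord_projection (- I) :: complex ^ 'a \<Rightarrow> _"
  show "open U" "w \<in> U"
    by fact+
  show "smooth_on U ?g"
    by (intro smooth_on_polynomial_function polynomial_function_bounded_linear bounded_linear_coord_projection)
  show "subspace (coord_subspace (- I))"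
    by (auto simp: subspace_def coord_subspace_def)
  show "?g ` U \<subseteq> coord_subspace (- I)"
    by (auto simp: coord_projection_def coord_subspace_def)
  have "frechet_derivative ?g (at w) = ?g"
    by (rule frechet_derivative_at[OF bounded_linear_imp_has_derivative[OF bounded_linear_coord_projection], symmetric])
  moreover have "range ?g = coord_subspace (- I)"
  proof
    show "range ?g \<subseteq> coord_subspace (- I)"
      by (auto simp: coord_projection_def coord_subspace_def)
    have "y = ?g y" if "y \<in> coord_subspace (- I)" for y
      using that by (auto simp: coord_projection_def coord_subspace_def vec_eq_iff)
    then show "coord_subspace (- I) \<subseteq> range ?g"
      by blast
  qed
  ultimately show "range (frechet_derivative ?g (at w)) = coord_subspace (- I)"
    by simp
  have "?g x = 0 \<longleftrightarrow> x \<in> coord_subspace I" for x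
    by (auto simp: coord_projection_def coord_subspace_def vec_eq_iff)
  then show "M \<inter> U = {x \<in> U. ?g x = 0}"
    using assms(3) by auto
qed

text \<open>The coordinates outside \<open>I\<close> together with \<open>f\<close> are defining equations.  The value of \<open>f\<close> is
  stored in a coordinate \<open>i0\<close> of \<open>I\<close>, which the other equations leave free.\<close>

lemma smooth_submanifold_at_zero_set_in_coord_torus:
  assumes sub: "torus_submersive (mixed_eval f) w" and w: "w \<in> coord_torus I"
  shows "smooth_submanifold_at (mixed_eval f -` {0} \<inter> coord_torus I) w"
proof -
  let ?f = "mixed_eval f"
  let ?F = "frechet_derivative ?f (at w)"
  have lin: "linear ?F" and f_deriv: "(?f has_derivative ?F) (at w)"
    using linear_frechet_derivative_mixed_sum mixed_sum_has_derivative
    by (simp_all add: mixed_eval_eq_mixed_sum)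
  have "I \<noteq> {}"
  proof
    assume "I = {}"
    then have "w * u = 0" for u
      using w by (auto simp: coord_torus_def coord_subspace_def vec_eq_iff)
    then show False
      using sub linear_0[OF lin] by (auto simp: torus_submersive_def)
  qed
  then obtain i0 where i0: "i0 \<in> I" by blast
  define p where "p = (coord_projection (- I) :: complex ^ 'a \<Rightarrow> _)"
  define g where "g x = p x + axis i0 (?f x)" for x
  define W :: "(complex ^ 'a) set" where "W = {y. \<forall>j\<in>I. j \<noteq> i0 \<longrightarrow> y $ j = 0}"
  have p: "bounded_linear p"
    by (simp add: p_def bounded_linear_coord_projection)
  have axis: "bounded_linear (axis i0 :: complex \<Rightarrow> complex ^ 'a)"
    by (intro linear_conv_bounded_linear[THEN iffD1] linearI) (auto simp: axis_def vec_eq_iff)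
  have g_nth: "g x $ j = (if j \<in> I then if j = i0 then ?f x else 0 else x $ j)" for x j
    using i0 by (auto simp: g_def p_def coord_projection_def axis_def)
  have "polynomial_function ?f"
    by (simp add: mixed_eval_eq_mixed_sum polynomial_function_mixed_sum)
  from polynomial_function_compose[OF this polynomial_function_bounded_linear[OF axis]]
  have "polynomial_function g"
    by (simp add: g_def[abs_def] o_def polynomial_function_add polynomial_function_bounded_linear[OF p])
  have "(g has_derivative (\<lambda>h. p h + axis i0 (?F h))) (at w)"
    unfolding g_def
    by (intro has_derivative_add bounded_linear_imp_has_derivative p
        bounded_linear.has_derivative[OF axis] f_deriv)
  then have g_deriv: "frechet_derivative g (at w) = (\<lambda>h. p h + axis i0 (?F h))"
    by (rule frechet_derivative_at[symmetric])
  have "range (frechet_derivative g (at w)) = W"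
  proof
    show "range (frechet_derivative g (at w)) \<subseteq> W"
      by (auto simp: g_deriv W_def p_def coord_projection_def axis_def)
    show "W \<subseteq> range (frechet_derivative g (at w))"
    proof
      fix y assume y: "y \<in> W"
      obtain u where u: "?F (w * u) = y $ i0 - ?F (p y)"
        using surjD[OF sub[unfolded torus_submersive_def], of "y $ i0 - ?F (p y)"] by metis
      \<comment> \<open>The vector \<open>w * u\<close> has no component outside \<open>I\<close>, so it adjusts the value of \<open>?F\<close> alone.\<close>
      define h where "h = p y + w * u"
      have "?F h = y $ i0"
        using u lin by (simp add: h_def linear_add)
      moreover have "p h = p y"
        using w by (auto simp: h_def p_def coord_projection_def coord_torus_def coord_subspace_def vec_eq_iff)
      moreover have "p y + axis i0 (y $ i0) = y"
        using y i0 by (auto simp: p_def coord_projection_def W_def axis_def vec_eq_iff)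
      ultimately have "y = frechet_derivative g (at w) h"
        by (simp add: g_deriv)
      then show "y \<in> range (frechet_derivative g (at w))"
        by blast
    qed
  qed
  moreover have "g ` {x. \<forall>j\<in>I. x $ j \<noteq> 0} \<subseteq> W"
    by (auto simp: W_def g_nth)
  moreover have "subspace W"
    by (auto simp: W_def subspace_def)
  moreover have "?f -` {0} \<inter> coord_torus I \<inter> {x. \<forall>j\<in>I. x $ j \<noteq> 0}
      = {x \<in> {x. \<forall>j\<in>I. x $ j \<noteq> 0}. g x = 0}"
    using i0 by (auto simp: vec_eq_iff g_nth coord_torus_def coord_subspace_def)
  moreover have "w \<in> {x. \<forall>j\<in>I. x $ j \<noteq> 0}"
    using w by (simp add: coord_torus_def)
  ultimately show ?thesis
    unfolding smooth_submanifold_at_def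
    using open_nonzero_coords[of I] smooth_on_polynomial_function[OF \<open>polynomial_function g\<close>] by blast
qed

lemma stratification_canonical:
  assumes "0 < r"
    and sub: "\<And>z. \<lbrakk>z \<in> cball 0 r; \<exists>m\<in>Poly_Mapping.keys f. mixed_monom m z \<noteq> 0\<rbrakk>
        \<Longrightarrow> torus_submersive (mixed_eval f) z"
  shows "stratification_at_origin (canonical_stratification f)"
  unfolding stratification_at_origin_def
proof (intro conjI exI[of _ r] ballI)
  show "\<Union> (canonical_stratification f) = UNIV"
    using canonical_stratum_in_stratification mem_canonical_stratum by blast
  show "pairwise disjnt (canonical_stratification f)"
    unfolding pairwise_def disjnt_def using canonical_stratum_unique by blast
  show "0 < r" by fact
  have "finite (canonical_stratification f)"
    unfolding canonical_stratification_def Let_def by (simp add: Setcompr_eq_image)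
  then show "finite {M \<in> canonical_stratification f. M \<inter> cball 0 r \<noteq> {}}"
    by simp
  fix M w assume M: "M \<in> canonical_stratification f" and w: "w \<in> M \<inter> cball 0 r"
  define I where "I = {i. w $ i \<noteq> 0}"
  define U :: "(complex ^ 'a) set" where "U = {x. \<forall>j\<in>I. x $ j \<noteq> 0}"
  have wI: "w \<in> coord_torus I"
    by (simp add: coord_torus_iff_support I_def)
  have U: "open U" "w \<in> U" "coord_torus I \<inter> U = coord_subspace I \<inter> U"
    using open_nonzero_coords[of I] wI by (auto simp: U_def coord_torus_def)
  have M_eq: "M = canonical_stratum f w"
    using M w canonical_stratum_unique by blast
  consider "I \<in> vanishing_sets f" | "I \<in> nonvanishing_sets f" "mixed_eval f w = 0"
    | "I \<in> nonvanishing_sets f" "mixed_eval f w \<noteq> 0"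
    using vanishing_iff_not_nonvanishing by blast
  then show "smooth_submanifold_at M w"
  proof cases
    case 1
    then have "M = coord_torus I"
      using M_eq by (simp add: canonical_stratum_def I_def)
    then show ?thesis
      using smooth_submanifold_at_open_in_coord_subspace U by blast
  next
    case 2
    then have "M = mixed_eval f -` {0} \<inter> coord_torus I"
      using M_eq by (simp add: canonical_stratum_def vanishing_iff_not_nonvanishing flip: I_def)
    moreover have "torus_submersive (mixed_eval f) w"
      using sub w nonzero_monomial_of_nonvanishing[OF 2(1) wI] by blast
    ultimately show ?thesis
      using smooth_submanifold_at_zero_set_in_coord_torus wI by blast
  next
    case 3
    let ?U = "U \<inter> - (mixed_eval f -` {0})"
    have "M = coord_torus I - (mixed_eval f -` {0} \<inter> coord_subspace I)"
      using M_eq 3 by (simp add: canonical_stratum_def vanishing_iff_not_nonvanishing flip: I_def)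
    then have "M \<inter> ?U = coord_subspace I \<inter> ?U"
      using U(3) by (auto simp: coord_torus_def)
    moreover have "continuous_on UNIV (mixed_eval f)"
      by (simp add: mixed_eval_eq_mixed_sum continuous_on_polymonial_function polynomial_function_mixed_sum)
    then have "closed (mixed_eval f -` {0})"
      by (simp add: closed_vimage)
    then have "open ?U"
      using U(1) by auto
    ultimately show ?thesis
      using smooth_submanifold_at_open_in_coord_subspace[of ?U w M I] U(2) 3(2) by auto
  qed
qed


section \<open>Tangent spaces and their limits in the Grassmannian\<close>

lemma tangent_space_subset_kernel:
  assumes "M \<subseteq> f -` {c}" "(f has_derivative F) (at w)" "v \<in> tangent_space M w"
  shows "F v = 0"
proof -
  obtain \<gamma> where \<gamma>: "\<gamma> 0 = w" "\<forall>\<^sub>F t in nhds (0 :: real). \<gamma> t \<in> M" "(\<gamma> has_vector_derivative v) (at 0)"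
    using assms(3) by (auto simp: tangent_space_def)
  have "((\<lambda>t. f (\<gamma> t)) has_derivative (\<lambda>t. F (t *\<^sub>R v))) (at 0)"
    using has_derivative_compose[OF \<gamma>(3)[unfolded has_vector_derivative_def]] assms(2) \<gamma>(1) by auto
  moreover obtain S where S: "open S" "0 \<in> S" "\<And>t. t \<in> S \<Longrightarrow> \<gamma> t \<in> M"
    using \<gamma>(2) unfolding eventually_nhds by blast
  have "c = f (\<gamma> t)" if "t \<in> S" for t
    using S(3)[OF that] assms(1) by auto
  then have "((\<lambda>t. f (\<gamma> t)) has_derivative (\<lambda>t. 0)) (at 0)"
    by (rule has_derivative_transform_within_open[OF has_derivative_const S(1,2)])
  ultimately have "(\<lambda>t. F (t *\<^sub>R v)) = (\<lambda>t. 0)"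
    by (rule has_derivative_unique)
  from fun_cong[OF this, of 1] show ?thesis by simp
qed

lemma tangent_space_coord_subspace:
  assumes "M \<subseteq> coord_subspace I" "v \<in> tangent_space M w"
  shows "v \<in> coord_subspace I"
proof -
  have "v $ j = 0" if "j \<notin> I" for j
  proof (rule tangent_space_subset_kernel[where f = "\<lambda>x. x $ j" and F = "\<lambda>x. x $ j", OF _ _ assms(2)])
    show "M \<subseteq> (\<lambda>x. x $ j) -` {0}"
      using assms(1) that by (auto simp: coord_subspace_def)
    show "((\<lambda>x. x $ j) has_derivative (\<lambda>x. x $ j)) (at w)"
      by (rule bounded_linear_imp_has_derivative[OF bounded_linear_vec_nth])
  qed
  then show ?thesis by (simp add: coord_subspace_def)
qed

text \<open>Half of the rank formula: a surjective map stays surjective on the orthogonal complement of its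
  kernel.\<close>

lemma dim_kernel_surjective:
  fixes F :: "'a::euclidean_space \<Rightarrow> 'b::euclidean_space"
  assumes "linear F" "range F = UNIV"
  shows "dim {x. F x = 0} + DIM('b) \<le> DIM('a)"
proof -
  let ?N = "{x. F x = 0}" and ?N' = "{y \<in> UNIV. \<forall>x\<in>{x. F x = 0}. orthogonal x y}"
  have N: "subspace ?N"
    using assms(1) by (rule linear_subspace_kernel)
  have "F ` ?N' = UNIV"
  proof -
    have "b \<in> F ` ?N'" for b
    proof -
      obtain x where "b = F x"
        using assms(2) by (metis UNIV_I image_iff)
      obtain y z where yz: "y \<in> span ?N" "\<And>w. w \<in> span ?N \<Longrightarrow> orthogonal z w" "x = y + z"
        using orthogonal_subspace_decomp_exists[of ?N x] by blast
      have "F y = 0"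
        using yz(1) N span_eq_iff[of ?N] by blast
      moreover have "z \<in> ?N'"
        using yz(2)[OF span_base] by (auto simp: orthogonal_commute)
      ultimately show ?thesis
        using \<open>b = F x\<close> yz(3) linear_add[OF assms(1)] by auto
    qed
    then show ?thesis by blast
  qed
  then have "DIM('b) \<le> dim ?N'"
    using dim_image_le[OF assms(1), of ?N'] by (simp add: dim_UNIV)
  moreover have "dim ?N' + dim ?N = DIM('a)"
    using dim_subspace_orthogonal_to_vectors[OF N, of UNIV] by (simp add: dim_UNIV)
  ultimately show ?thesis by linarith
qed

text \<open>A vector belongs to the limit plane as soon as its distance to the planes \<open>W (r k)\<close> tends to
  \<open>0\<close>; the vectors \<open>u k\<close> witness this.\<close>

lemma grassmannian_limit_contains:
  assumes lim: "grassmannian_tendsto d W \<tau>" and r: "strict_mono r"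
    and u: "u \<longlonglongrightarrow> 0" "\<forall>\<^sub>F k in sequentially. v - u k \<in> W (r k)"
  shows "v \<in> \<tau>"
proof -
  have \<tau>: "subspace \<tau>" and sub: "\<forall>\<^sub>F k in sequentially. subspace (W k)"
    and cp: "(\<lambda>k. closest_point (W k) v) \<longlonglongrightarrow> closest_point \<tau> v"
    using lim by (auto simp: grassmannian_tendsto_def elim: eventually_mono)
  have "\<forall>\<^sub>F k in sequentially. subspace (W (r k))"
    using sub r by (rule eventually_subseq[rotated])
  with u(2) have "\<forall>\<^sub>F k in sequentially. norm (closest_point (W (r k)) v - v) \<le> norm (u k)"
  proof eventually_elim
    case (elim k)
    then show ?case
      using closest_point_le[OF closed_subspace[OF elim(2)] elim(1), of v]
      by (simp add: dist_norm norm_minus_commute)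
  qed
  then have "(\<lambda>k. closest_point (W (r k)) v - v) \<longlonglongrightarrow> 0"
    using tendsto_norm_zero[OF u(1)] by (rule Lim_null_comparison)
  then have "(\<lambda>k. closest_point (W (r k)) v) \<longlonglongrightarrow> v"
    by (simp add: Lim_null[symmetric])
  moreover have "(\<lambda>k. closest_point (W (r k)) v) \<longlonglongrightarrow> closest_point \<tau> v"
    using LIMSEQ_subseq_LIMSEQ[OF cp r] by (simp add: o_def)
  ultimately have "closest_point \<tau> v = v"
    using LIMSEQ_unique by blast
  then show ?thesis
    using closest_point_in_set[OF closed_subspace[OF \<tau>]] subspace_0[OF \<tau>] by (metis empty_iff)
qed

text \<open>A vector \<open>v\<close> is moved into the kernel of \<open>A k\<close> by subtracting a real combination of \<open>e1 k\<close> and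
  \<open>e2 k\<close>, whose images, divided by \<open>c k\<close>, are almost \<open>1\<close> and \<open>\<i>\<close>.  The correction tends to \<open>0\<close>
  for one of two reasons: the coefficients do (\<open>g = 0\<close>), or the vectors do.  The first occurs at
  points where \<open>f\<close> is submersive, the second at vanishing coordinate subspaces.\<close>

lemma kernel_correction:
  fixes A :: "nat \<Rightarrow> 'a::real_normed_vector \<Rightarrow> complex" and c :: "nat \<Rightarrow> real"
  assumes A: "\<And>k. linear (A k)" and c: "\<And>k. 0 < c k"
    and e: "e1 \<longlonglongrightarrow> E1" "e2 \<longlonglongrightarrow> E2"
    and lim: "(\<lambda>k. A k (e1 k) / of_real (c k)) \<longlonglongrightarrow> 1" "(\<lambda>k. A k (e2 k) / of_real (c k)) \<longlonglongrightarrow> \<i>"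
      "(\<lambda>k. A k v / of_real (c k)) \<longlonglongrightarrow> g"
    and small: "g = 0 \<or> E1 = 0 \<and> E2 = 0"
  obtains u where "u \<longlonglongrightarrow> 0" "\<forall>\<^sub>F k in sequentially. A k (v - u k) = 0"
proof -
  define \<alpha> where "\<alpha> k = A k (e1 k) / of_real (c k)" for k
  define \<beta> where "\<beta> k = A k (e2 k) / of_real (c k)" for k
  define \<gamma> where "\<gamma> k = A k v / of_real (c k)" for k
  have \<alpha>: "\<alpha> \<longlonglongrightarrow> 1" and \<beta>: "\<beta> \<longlonglongrightarrow> \<i>" and \<gamma>: "\<gamma> \<longlonglongrightarrow> g"
    using lim by (simp_all add: \<alpha>_def[abs_def] \<beta>_def[abs_def] \<gamma>_def[abs_def])
  define d where "d k = Im (cnj (\<alpha> k) * \<beta> k)" for k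
  define s where "s k = Im (cnj (\<gamma> k) * \<beta> k) / d k" for k
  define t where "t k = Im (cnj (\<alpha> k) * \<gamma> k) / d k" for k
  have d: "d \<longlonglongrightarrow> Im (cnj 1 * \<i>)"
    unfolding d_def by (intro tendsto_intros \<alpha> \<beta>)
  have s: "s \<longlonglongrightarrow> Im (cnj g * \<i>) / Im (cnj 1 * \<i>)"
    unfolding s_def by (intro tendsto_divide d tendsto_intros \<beta> \<gamma>) simp
  have t: "t \<longlonglongrightarrow> Im (cnj 1 * g) / Im (cnj 1 * \<i>)"
    unfolding t_def by (intro tendsto_divide d tendsto_intros \<alpha> \<gamma>) simp
  have "(\<lambda>k. s k *\<^sub>R e1 k + t k *\<^sub>R e2 k) \<longlonglongrightarrow>
      (Im (cnj g * \<i>) / Im (cnj 1 * \<i>)) *\<^sub>R E1 + (Im (cnj 1 * g) / Im (cnj 1 * \<i>)) *\<^sub>R E2"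
    by (intro tendsto_add tendsto_scaleR s t e)
  moreover have "(Im (cnj g * \<i>) / Im (cnj 1 * \<i>)) *\<^sub>R E1 + (Im (cnj 1 * g) / Im (cnj 1 * \<i>)) *\<^sub>R E2 = 0"
    using small by auto
  ultimately have "(\<lambda>k. s k *\<^sub>R e1 k + t k *\<^sub>R e2 k) \<longlonglongrightarrow> 0"
    by simp
  moreover have "\<forall>\<^sub>F k in sequentially. d k \<noteq> 0"
    using d by (rule tendsto_imp_eventually_ne) simp
  then have "\<forall>\<^sub>F k in sequentially. A k (v - (s k *\<^sub>R e1 k + t k *\<^sub>R e2 k)) = 0"
  proof eventually_elim
    case (elim k)
    have "of_real (s k) * \<alpha> k + of_real (t k) * \<beta> k = \<gamma> k"
      using real_combination_of_complex[of "\<alpha> k" "\<beta> k" "\<gamma> k"] elim by (simp add: s_def t_def d_def)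
    then have "of_real (s k) * A k (e1 k) + of_real (t k) * A k (e2 k) = A k v"
      using c[of k] by (simp add: \<alpha>_def \<beta>_def \<gamma>_def field_simps)
    then show ?case
      using A[of k] by (simp add: linear_diff linear_add linear_scale scaleR_conv_of_real[where 'a = complex])
  qed
  ultimately show thesis by (rule that)
qed


section \<open>Thom's condition\<close>

text \<open>The functions that occur in local tameness depend on the face \<open>\<Delta>\<close> only through the finite set of
  exponents of \<open>f\<close> in \<open>\<Delta>\<close>, so finitely many radii have to be compared.\<close>

lemma uniform_tameness_radius:
  assumes "locally_tame_along_vanishing f"
  obtains r where "0 < r"
    "\<And>I \<Delta> a x. \<lbrakk>I \<in> vanishing_sets f; I \<noteq> {}; essential_face_on f I \<Delta>; \<forall>j\<in>I. a $ j \<noteq> 0;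
        partial_norm_sq I a \<le> r\<^sup>2; x \<in> coord_torus (- I)\<rbrakk>
      \<Longrightarrow> \<not> critical_point (\<lambda>x. face_fun f \<Delta> (merge_coords I a x)) x"
proof -
  define tame where "tame I D r \<longleftrightarrow> (\<forall>a x. (\<forall>j\<in>I. a $ j \<noteq> 0) \<and> partial_norm_sq I a \<le> r\<^sup>2 \<and> x \<in> coord_torus (- I) \<longrightarrow>
      \<not> critical_point (\<lambda>x. mixed_sum (Poly_Mapping.lookup f) D (merge_coords I a x)) x)" for I D r
  have "\<exists>r>0. \<forall>\<Delta>. I \<in> vanishing_sets f \<and> I \<noteq> {} \<and> essential_face_on f I \<Delta> \<and> face_keys f \<Delta> = D \<longrightarrow> tame I D r"
    for I D
  proof (cases "\<exists>\<Delta>. I \<in> vanishing_sets f \<and> I \<noteq> {} \<and> essential_face_on f I \<Delta> \<and> face_keys f \<Delta> = D")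
    case True
    then obtain \<Delta> where \<Delta>: "I \<in> vanishing_sets f" "I \<noteq> {}" "essential_face_on f I \<Delta>" "face_keys f \<Delta> = D"
      by blast
    then have "locally_tame_face f I \<Delta>"
      using assms by (simp add: locally_tame_along_vanishing_def locally_tame_on_def)
    then obtain r where "0 < r" "tame I D r"
      unfolding locally_tame_face_def face_fun_eq_mixed_sum \<Delta>(4) tame_def by blast
    then show ?thesis by blast
  next
    case False
    then show ?thesis by (intro exI[of _ 1]) auto
  qed
  then obtain \<rho> where \<rho>: "\<And>I D. 0 < \<rho> I D"
    "\<And>I \<Delta>. \<lbrakk>I \<in> vanishing_sets f; I \<noteq> {}; essential_face_on f I \<Delta>\<rbrakk> \<Longrightarrow> tame I (face_keys f \<Delta>) (\<rho> I (face_keys f \<Delta>))"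
    by metis
  \<comment> \<open>A set \<open>D\<close> that comes from no essential face contributes an arbitrary positive number.\<close>
  define R where "R = (\<lambda>(I, D). \<rho> I D) ` (UNIV \<times> Pow (Poly_Mapping.keys f))"
  have R: "finite R" "R \<noteq> {}"
    by (auto simp: R_def)
  define r where "r = Min R"
  have "0 < r"
    unfolding r_def using R by (subst Min_gr_iff) (auto simp: R_def \<rho>(1))
  moreover have "\<not> critical_point (\<lambda>x. face_fun f \<Delta> (merge_coords I a x)) x"
    if "I \<in> vanishing_sets f" "I \<noteq> {}" "essential_face_on f I \<Delta>" "\<forall>j\<in>I. a $ j \<noteq> 0"
      "partial_norm_sq I a \<le> r\<^sup>2" "x \<in> coord_torus (- I)" for I \<Delta> a x
  proof -
    have "\<rho> I (face_keys f \<Delta>) \<in> R"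
      by (auto simp: R_def face_keys_def)
    then have "r \<le> \<rho> I (face_keys f \<Delta>)"
      unfolding r_def using R(1) by (rule Min_le[rotated])
    then have "r\<^sup>2 \<le> (\<rho> I (face_keys f \<Delta>))\<^sup>2"
      using \<open>0 < r\<close> by (intro power_mono) auto
    then have "partial_norm_sq I a \<le> (\<rho> I (face_keys f \<Delta>))\<^sup>2"
      using that(5) by linarith
    then show ?thesis
      using \<rho>(2)[OF that(1-3)] that(4,6) unfolding tame_def face_fun_eq_mixed_sum by blast
  qed
  ultimately show thesis by (rule that)
qed

text \<open>Velocities of curves in the fibre lie in the kernel of the differential.  Since the dimension of
  the tangent space is given, equality follows without constructing curves.\<close>

lemma tangent_space_level_eq_kernel:
  assumes lin: "linear F" and surj: "range F = UNIV" and deriv: "(f has_derivative F) (at z)"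
    and W: "subspace (tangent_space (f -` {f z}) z)"
      "dim (tangent_space (f -` {f z}) z) = DIM('a) - DIM(complex)"
  shows "tangent_space (f -` {f z}) (z :: 'a::euclidean_space) = {v. F v = (0 :: complex)}"
proof (rule subspace_dim_equal[OF W(1)])
  show "subspace {v. F v = 0}"
    using lin by (rule linear_subspace_kernel)
  show "tangent_space (f -` {f z}) z \<subseteq> {v. F v = 0}"
    using tangent_space_subset_kernel[OF order_refl deriv] by blast
  show "dim {v. F v = 0} \<le> dim (tangent_space (f -` {f z}) z)"
    using dim_kernel_surjective[OF lin surj] W(2) by linarith
qed

lemma tangent_limit_at_submersive_point:
  fixes f :: "'n::finite mixed_poly"
  defines "A \<equiv> \<lambda>z. frechet_derivative (mixed_eval f) (at z)"
  assumes z: "z \<longlonglongrightarrow> w" and sub: "torus_submersive (mixed_eval f) w"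
    and lim: "grassmannian_tendsto d W \<tau>" and ker: "\<forall>\<^sub>F k in sequentially. W k = {v. A (z k) v = 0}"
    and v: "A w v = 0"
  shows "v \<in> \<tau>"
proof -
  have A: "linear (A z)" for z
    using linear_frechet_derivative_mixed_sum by (simp add: A_def mixed_eval_eq_mixed_sum)
  have A_lim: "(\<lambda>k. A (z k) b) \<longlonglongrightarrow> A w b" for b
  proof -
    have "polynomial_function (\<lambda>z. A z b)"
      by (simp add: A_def mixed_eval_eq_mixed_sum polynomial_function_frechet_derivative polynomial_function_mixed_sum)
    then show ?thesis
      using continuous_polymonial_function isCont_tendsto_compose z by blast
  qed
  have surj: "\<exists>u. y = A w (w * u)" for y
    using surjD[OF sub[unfolded torus_submersive_def]] by (simp add: A_def)
  obtain u1 u2 where u: "1 = A w (w * u1)" "\<i> = A w (w * u2)"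
    using surj[of 1] surj[of \<i>] by (elim exE)
  obtain u where u_lim: "u \<longlonglongrightarrow> 0" and ev: "\<forall>\<^sub>F k in sequentially. A (z k) (v - u k) = 0"
  proof (rule kernel_correction[where A = "\<lambda>k. A (z k)" and c = "\<lambda>_. 1" and v = v and g = 0
        and ?e1.0 = "\<lambda>_. w * u1" and ?e2.0 = "\<lambda>_. w * u2"])
    show "(\<lambda>k. A (z k) (w * u1) / complex_of_real 1) \<longlonglongrightarrow> 1"
      "(\<lambda>k. A (z k) (w * u2) / complex_of_real 1) \<longlonglongrightarrow> \<i>"
      "(\<lambda>k. A (z k) v / complex_of_real 1) \<longlonglongrightarrow> 0"
      using A_lim[of "w * u1"] A_lim[of "w * u2"] A_lim[of v] u v by simp_all
  qed (use A in auto)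
  have "\<forall>\<^sub>F k in sequentially. v - u k \<in> W (id k)"
    using ev ker by eventually_elim auto
  then show ?thesis
    using grassmannian_limit_contains[OF lim strict_mono_id u_lim] by blast
qed

text \<open>Along the sequence the weight \<open>P\<close> vanishes exactly on \<open>I\<close>, so its face \<open>\<Delta>\<close> is essential.
  In units of the scale \<open>c k\<close> the derivative of \<open>f\<close> along \<open>v \<in> \<complex>\<^sup>I\<close> stays bounded, because the
  coordinates in \<open>I\<close> stay away from \<open>0\<close>.  By tameness, \<open>f\<^sub>\<Delta>\<close> is submersive in the remaining variables,
  so directions \<open>z * u\<close> with \<open>u\<close> supported outside \<open>I\<close> reach every complex number at this scale.
  These directions tend to \<open>0\<close> with the coordinates outside \<open>I\<close>, hence \<open>v\<close> is corrected into the
  kernel of the differential by vectors that tend to \<open>0\<close>.\<close>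

lemma tangent_limit_at_vanishing_point:
  fixes f :: "'n::finite mixed_poly"
  defines "A \<equiv> \<lambda>z. frechet_derivative (mixed_eval f) (at z)"
  assumes z: "z \<longlonglongrightarrow> w" and nz: "\<And>k. \<exists>m\<in>Poly_Mapping.keys f. mixed_monom m (z k) \<noteq> 0"
    and I: "I = {i. w $ i \<noteq> 0}" "I \<in> vanishing_sets f" "I \<noteq> {}"
    and tame: "\<And>\<Delta> a x. \<lbrakk>essential_face_on f I \<Delta>; \<forall>j\<in>I. a $ j = w $ j; x \<in> coord_torus (- I)\<rbrakk>
      \<Longrightarrow> \<not> critical_point (\<lambda>x. face_fun f \<Delta> (merge_coords I a x)) x"
    and lim: "grassmannian_tendsto d W \<tau>" and ker: "\<forall>\<^sub>F k in sequentially. W k = {v. A (z k) v = 0}"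
    and v: "v \<in> coord_subspace I"
  shows "v \<in> \<tau>"
proof -
  define K where "K = Poly_Mapping.keys f"
  define h where "h = Poly_Mapping.lookup f"
  have K: "finite K"
    by (simp add: K_def)
  have nzK: "\<exists>m\<in>K. mixed_monom m (z k) \<noteq> 0" for k
    using nz by (simp add: K_def)
  have A_def': "A z = frechet_derivative (mixed_sum h K) (at z)" for z
    by (simp add: A_def mixed_eval_eq_mixed_sum h_def K_def)
  have A: "linear (A z)" for z
    unfolding A_def' by (rule linear_frechet_derivative_mixed_sum)
  obtain r :: "nat \<Rightarrow> nat" and P :: "real ^ 'n" and a c m0 where
    r: "strict_mono r" and P: "\<And>i. 0 \<le> P $ i" "\<And>i. P $ i = 0 \<longleftrightarrow> w $ i \<noteq> 0" and
    a: "\<And>i. a $ i \<noteq> 0" "\<And>i. w $ i \<noteq> 0 \<Longrightarrow> a $ i = w $ i" and c: "\<And>k. 0 < c k" and m0: "m0 \<in> K"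
    "\<And>m. m \<in> K \<Longrightarrow> P \<bullet> total_exponent m0 \<le> P \<bullet> total_exponent m" and
    monom_lim: "\<And>m. m \<in> K \<Longrightarrow> (\<lambda>k. mixed_monom m (z (r k)) / of_real (c k))
        \<longlonglongrightarrow> (if P \<bullet> total_exponent m = P \<bullet> total_exponent m0 then mixed_monom m a else 0)"
    using monomial_asymptotics[OF z K nzK] by blast
  define \<Delta> where "\<Delta> = weight_face f P"
  have I_eq: "weight_zeros P = I"
    using P(2) by (auto simp: weight_zeros_def I(1))
  have essential: "essential_face_on f I \<Delta>"
    unfolding \<Delta>_def I_eq[symmetric]
    by (rule essential_face_on_weight_face[of P m0]) (use P m0 I I_eq in \<open>auto simp: K_def\<close>)
  define D where "D = face_keys f \<Delta>"
  have D: "D = {m \<in> K. P \<bullet> total_exponent m = P \<bullet> total_exponent m0}"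
    unfolding D_def \<Delta>_def using P m0 by (subst face_keys_weight_face[of P m0]) (auto simp: K_def)
  have zr: "(\<lambda>k. z (r k)) \<longlonglongrightarrow> w"
    using LIMSEQ_subseq_LIMSEQ[OF z r] by (simp add: o_def)
  have scaled_lim: "(\<lambda>k. A (z (r k)) (z (r k) * u k) / of_real (c k))
      \<longlonglongrightarrow> frechet_derivative (mixed_sum h D) (at a) (a * u0)" if "u \<longlonglongrightarrow> u0" for u u0
    unfolding A_def'
  proof (rule frechet_derivative_asymptotics[OF K _ _ that])
    show "D \<subseteq> K"
      by (auto simp: D)
    show "(\<lambda>k. mixed_monom m (z (r k)) / of_real (c k)) \<longlonglongrightarrow> (if m \<in> D then mixed_monom m a else 0)"
      if "m \<in> K" for m
      using monom_lim[OF that] that by (simp add: D)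
  qed
  \<comment> \<open>The face function with the coordinates in \<open>I\<close> frozen has the differential of \<open>f\<^sub>\<Delta>\<close> along \<open>q\<close>.\<close>
  define q where "q = (coord_projection (- I) :: complex ^ 'n \<Rightarrow> _)"
  have merge: "merge_coords I a x = coord_projection I a + q x" for x
    by (auto simp: merge_coords_def coord_projection_def q_def vec_eq_iff)
  have a_eq: "merge_coords I a (q a) = a"
    by (auto simp: merge_coords_def coord_projection_def q_def vec_eq_iff)
  have "q a \<in> coord_torus (- I)"
    using a(1) by (auto simp: coord_torus_def coord_subspace_def coord_projection_def q_def)
  then have noncritical: "\<not> critical_point (\<lambda>x. mixed_sum h D (merge_coords I a x)) (q a)"
    using tame[OF essential, of a "q a"] a(2) by (simp add: I(1) face_fun_eq_mixed_sum D_def h_def)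
  have "((\<lambda>x. merge_coords I a x) has_derivative q) (at x)" for x
    unfolding merge q_def
    by (rule has_derivative_eq_rhs, rule has_derivative_add[OF has_derivative_const
          bounded_linear_imp_has_derivative[OF bounded_linear_coord_projection]]) simp
  then have deriv: "((\<lambda>x. mixed_sum h D (merge_coords I a x)) has_derivative
      (\<lambda>x. frechet_derivative (mixed_sum h D) (at a) (q x))) (at (q a))"
    by (rule has_derivative_compose) (simp add: a_eq mixed_sum_has_derivative)
  have surj: "range (\<lambda>x. frechet_derivative (mixed_sum h D) (at a) (q x)) = UNIV"
    using noncritical not_critical_point_iff[OF differentiableI[OF deriv]]
    by (simp add: frechet_derivative_at[OF deriv, symmetric])
  obtain b1 b2 where b: "1 = frechet_derivative (mixed_sum h D) (at a) (q b1)"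
      "\<i> = frechet_derivative (mixed_sum h D) (at a) (q b2)"
    using surjD[OF surj, of 1] surjD[OF surj, of \<i>] by (elim exE)
  define u where "u b = (\<chi> i. q b $ i / a $ i)" for b :: "complex ^ 'n"
  have au: "a * u b = q b" for b
    using a(1) by (simp add: vec_eq_iff u_def)
  have wu: "w * u b = 0" for b
    by (auto simp: vec_eq_iff u_def q_def coord_projection_def I(1))
  have e_lim: "(\<lambda>k. z (r k) * u b) \<longlonglongrightarrow> 0" for b
  proof -
    have "(\<lambda>k. z (r k) * u b) \<longlonglongrightarrow> w * u b"
      by (intro vec_tendstoI) (auto intro!: tendsto_intros zr)
    then show ?thesis by (simp add: wu)
  qed
  have v_lim: "(\<lambda>k. A (z (r k)) v / of_real (c k))
      \<longlonglongrightarrow> frechet_derivative (mixed_sum h D) (at a) (a * (\<chi> i. v $ i / w $ i))"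
  proof -
    \<comment> \<open>Eventually \<open>v = z (r k) * p k\<close>; outside \<open>I\<close> this holds because \<open>v\<close> and \<open>p k\<close> are \<open>0\<close>.\<close>
    define p where "p k = (\<chi> i. v $ i / z (r k) $ i)" for k
    have "p \<longlonglongrightarrow> (\<chi> i. v $ i / w $ i)"
    proof (rule vec_tendstoI)
      fix i
      show "(\<lambda>k. p k $ i) \<longlonglongrightarrow> (\<chi> i. v $ i / w $ i) $ i"
      proof (cases "i \<in> I")
        case True
        then have "(\<lambda>k. v $ i / z (r k) $ i) \<longlonglongrightarrow> v $ i / w $ i"
          by (intro tendsto_divide tendsto_const tendsto_vec_nth zr) (simp add: I(1))
        then show ?thesis by (simp add: p_def)
      next
        case False
        then have "v $ i = 0"
          using v by (simp add: coord_subspace_def)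
        then show ?thesis by (simp add: p_def)
      qed
    qed
    from scaled_lim[OF this]
    have "(\<lambda>k. A (z (r k)) (z (r k) * p k) / of_real (c k))
        \<longlonglongrightarrow> frechet_derivative (mixed_sum h D) (at a) (a * (\<chi> i. v $ i / w $ i))" .
    moreover have "\<forall>\<^sub>F k in sequentially. \<forall>i\<in>I. z (r k) $ i \<noteq> 0"
      by (intro eventually_ball_finite ballI tendsto_imp_eventually_ne[OF tendsto_vec_nth[OF zr]])
        (auto simp: I(1))
    then have "\<forall>\<^sub>F k in sequentially. A (z (r k)) (z (r k) * p k) / of_real (c k) = A (z (r k)) v / of_real (c k)"
    proof eventually_elim
      case (elim k)
      have "z (r k) * p k = v"
        using elim v by (auto simp: vec_eq_iff p_def coord_subspace_def)
      then show ?case by simp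
    qed
    ultimately show ?thesis
      by (rule Lim_transform_eventually)
  qed
  obtain y where y_lim: "y \<longlonglongrightarrow> 0" and ev: "\<forall>\<^sub>F k in sequentially. A (z (r k)) (v - y k) = 0"
  proof (rule kernel_correction[where A = "\<lambda>k. A (z (r k))" and c = c and v = v
        and ?e1.0 = "\<lambda>k. z (r k) * u b1" and ?e2.0 = "\<lambda>k. z (r k) * u b2", OF A c e_lim e_lim _ _ v_lim])
    show "(\<lambda>k. A (z (r k)) (z (r k) * u b1) / of_real (c k)) \<longlonglongrightarrow> 1"
      "(\<lambda>k. A (z (r k)) (z (r k) * u b2) / of_real (c k)) \<longlonglongrightarrow> \<i>"
      using scaled_lim[OF tendsto_const, of "u b1"] scaled_lim[OF tendsto_const, of "u b2"]
      by (simp_all add: au flip: b)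
  qed auto
  have "\<forall>\<^sub>F k in sequentially. v - y k \<in> W (r k)"
    using ev eventually_subseq[OF r ker] by eventually_elim auto
  then show ?thesis
    using grassmannian_limit_contains[OF lim r y_lim] by blast
qed

theorem theorem20:
  fixes f :: "'n::finite mixed_poly"
  assumes "strongly_nondegenerate f"
    and "locally_tame_along_vanishing f"
  shows "thom_af_condition (mixed_eval f) (canonical_stratification f)"
proof -
  let ?f = "mixed_eval f" and ?S = "canonical_stratification f"
  obtain r1 where r1: "0 < r1" and sub: "\<And>z. \<lbrakk>z \<in> cball 0 r1;
      \<exists>m\<in>Poly_Mapping.keys f. mixed_monom m z \<noteq> 0\<rbrakk> \<Longrightarrow> torus_submersive ?f z"
    using torus_submersive_near_origin[OF assms(1)] by blast
  obtain r2 where r2: "0 < r2" and tame: "\<And>I \<Delta> a x. \<lbrakk>I \<in> vanishing_sets f; I \<noteq> {};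
      essential_face_on f I \<Delta>; \<forall>j\<in>I. a $ j \<noteq> 0; partial_norm_sq I a \<le> r2\<^sup>2; x \<in> coord_torus (- I)\<rbrakk>
      \<Longrightarrow> \<not> critical_point (\<lambda>x. face_fun f \<Delta> (merge_coords I a x)) x"
    using uniform_tameness_radius[OF assms(2)] by blast
  define r where "r = min r1 r2"
  have r: "0 < r" "r \<le> r1" "r \<le> r2"
    using r1 r2 by (auto simp: r_def)
  have deriv: "(?f has_derivative frechet_derivative ?f (at z)) (at z)" for z
    by (simp add: mixed_eval_eq_mixed_sum mixed_sum_has_derivative)
  have lin: "linear (frechet_derivative ?f (at z))" for z
    by (simp add: mixed_eval_eq_mixed_sum linear_frechet_derivative_mixed_sum)
  have surj: "range (frechet_derivative ?f (at z)) = UNIV" if "z \<in> cball 0 r" "?f z \<noteq> 0" for z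
  proof -
    have "torus_submersive ?f z"
      using sub[of z] nonzero_monomial_of_mixed_eval[OF that(2)] that(1) r(2) by auto
    then show ?thesis
      unfolding torus_submersive_def by blast
  qed
  have strat: "stratification_at_origin ?S"
    using stratification_canonical[OF r1 sub] .
  have zero_set: "?f -` {0} \<inter> cball 0 1 = \<Union> {M \<in> ?S. M \<subseteq> ?f -` {0}} \<inter> cball 0 1"
  proof -
    have "x \<in> \<Union> {M \<in> ?S. M \<subseteq> ?f -` {0}}" if "?f x = 0" for x
      using canonical_stratum_in_stratification mem_canonical_stratum
        canonical_stratum_subset_zero_set[OF that] by blast
    then show ?thesis by blast
  qed
  have noncritical: "\<not> critical_point ?f z" if "0 < norm (?f z)" "z \<in> cball 0 r" for z
    using surj[of z] that not_critical_point_iff[OF differentiableI[OF deriv]] by auto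
  have limit: "tangent_space M w \<subseteq> \<tau>"
    if z: "\<forall>k. z k \<in> cball 0 r \<and> ?f (z k) \<noteq> 0" "z \<longlonglongrightarrow> w" and w: "w \<noteq> 0"
      and M: "M \<in> ?S" "M \<subseteq> ?f -` {0}" "w \<in> M"
      and lim: "grassmannian_tendsto (2 * CARD('n) - 2) (\<lambda>k. tangent_space (?f -` {?f (z k)}) (z k)) \<tau>"
    for z w M \<tau>
  proof
    fix v assume v: "v \<in> tangent_space M w"
    have zk: "z k \<in> cball 0 r" "?f (z k) \<noteq> 0" for k
      using z(1) by auto
    define I where "I = {i. w $ i \<noteq> 0}"
    have wI: "w \<in> coord_torus I"
      by (simp add: I_def coord_torus_iff_support)
    have "w \<in> cball 0 r"
      using closed_sequentially[OF closed_cball _ z(2)] z(1) by blast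
    have "\<forall>\<^sub>F k in sequentially. subspace (tangent_space (?f -` {?f (z k)}) (z k))
        \<and> dim (tangent_space (?f -` {?f (z k)}) (z k)) = 2 * CARD('n) - 2"
      using lim by (simp add: grassmannian_tendsto_def)
    then have ker: "\<forall>\<^sub>F k in sequentially. tangent_space (?f -` {?f (z k)}) (z k)
        = {v. frechet_derivative ?f (at (z k)) v = 0}"
    proof eventually_elim
      case (elim k)
      then show ?case
        using zk[of k] surj by (intro tangent_space_level_eq_kernel lin deriv) auto
    qed
    show "v \<in> \<tau>"
    proof (cases "I \<in> vanishing_sets f")
      case False
      then have "torus_submersive ?f w"
        using sub nonzero_monomial_of_nonvanishing wI \<open>w \<in> cball 0 r\<close> r(2)
          vanishing_iff_not_nonvanishing by fastforce
      then show ?thesis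
        using tangent_limit_at_submersive_point[OF z(2) _ lim ker]
          tangent_space_subset_kernel[OF M(2) deriv v] by blast
    next
      case True
      have "M = coord_torus I"
        using canonical_stratum_unique[OF M(1,3)] True by (simp add: canonical_stratum_def I_def)
      then have "v \<in> coord_subspace I"
        using tangent_space_coord_subspace[OF _ v] by (auto simp: coord_torus_def)
      moreover have "I \<noteq> {}"
        using w by (auto simp: I_def vec_eq_iff)
      moreover have "\<not> critical_point (\<lambda>x. face_fun f \<Delta> (merge_coords I a x)) x"
        if "essential_face_on f I \<Delta>" "\<forall>j\<in>I. a $ j = w $ j" "x \<in> coord_torus (- I)" for \<Delta> a x
      proof -
        have "partial_norm_sq I a = (\<Sum>j\<in>I. (cmod (w $ j))\<^sup>2)"
          using that(2) by (simp add: partial_norm_sq_def)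
        also have "\<dots> \<le> (\<Sum>j\<in>UNIV. (cmod (w $ j))\<^sup>2)"
          by (intro sum_mono2) auto
        also have "\<dots> = (norm w)\<^sup>2"
          by (simp add: norm_vec_def L2_set_def sum_nonneg)
        also have "\<dots> \<le> r2\<^sup>2"
          using \<open>w \<in> cball 0 r\<close> r(3) by (intro power_mono) auto
        finally have "partial_norm_sq I a \<le> r2\<^sup>2" .
        moreover have "\<forall>j\<in>I. a $ j \<noteq> 0"
          using that(2) by (simp add: I_def)
        ultimately show ?thesis
          using tame True \<open>I \<noteq> {}\<close> that(1,3) by blast
      qed
      ultimately show ?thesis
        using nonzero_monomial_of_mixed_eval zk(2) True
        by (intro tangent_limit_at_vanishing_point[OF z(2) _ I_def _ _ _ lim ker]) blast+
    qed
  qed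
  show ?thesis
    unfolding thom_af_condition_def
  proof (intro conjI)
    show "stratification_at_origin ?S"
      by (fact strat)
    show "\<exists>r>0. ?f -` {0} \<inter> cball 0 r = \<Union> {M \<in> ?S. M \<subseteq> ?f -` {0}} \<inter> cball 0 r"
      by (rule exI[of _ 1]) (use zero_set in simp)
    show "\<exists>r>0. \<exists>\<delta>>0. \<delta> < r \<and>
        (\<forall>\<eta>. 0 < norm \<eta> \<and> norm \<eta> \<le> \<delta> \<longrightarrow> (\<forall>z\<in>?f -` {\<eta>} \<inter> cball 0 r. \<not> critical_point ?f z)) \<and>
        (\<forall>z w M \<tau>. (\<forall>k. z k \<in> cball 0 r \<and> ?f (z k) \<noteq> 0) \<and> z \<longlonglongrightarrow> w \<and> w \<noteq> 0 \<and>
           M \<in> ?S \<and> M \<subseteq> ?f -` {0} \<and> w \<in> M \<and>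
           grassmannian_tendsto (2 * CARD('n) - 2) (\<lambda>k. tangent_space (?f -` {?f (z k)}) (z k)) \<tau> \<longrightarrow>
           tangent_space M w \<subseteq> \<tau>)"
    proof (rule exI[of _ r], rule conjI[OF r(1)], rule exI[of _ "r / 2"], intro conjI allI impI ballI)
      show "0 < r / 2" "r / 2 < r"
        using r(1) by auto
    qed (use noncritical limit in blast)+
  qed
qed

end
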